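(* Let $m>0$, let $j\ge0$ be a half-integer, and let $(A,B)$ and $(C,D)$ be pairs of non-negative half-integers with $|A-B|\le j\le A+B$, $A+B-j\in\mathbb{Z}$, $|C-D|\le j\le C+D$, $C+D-j\in\mathbb{Z}$. Let $\pi^{AB,CD}(p)$ be the spin sum for mass $m$ and spin $j$. Then there is a polynomial $P(\mathbf p,p^0)$ in four variables whose coefficients are complex $(2A+1)(2B+1)\times(2C+1)(2D+1)$ matrices such that $$\pi^{AB,CD}\big(\mathbf p,\sqrt{\mathbf p^2+m^2}\big)=P\big(\mathbf p,\sqrt{\mathbf p^2+m^2}\big)\quad\text{for all }\mathbf p\in\mathbb{R}^3,$$ and $$P(-\mathbf p,-p^0)=(-1)^{2A+2D}P(\mathbf p,p^0)\quad\text{for all 4-vectors }p=(\mathbf p,p^0).$$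
   Context: Kinematics. The mass shell is $p^0=\sqrt{\mathbf p^2+m^2}$, with rest momentum $k=(\mathbf p=\mathbf 0,\,p^0=m)$. The covering $\lambda:SL(2,\mathbb{C})\to SO^+(1,3)$ is given by $X(\lambda(\Lambda)p)=\Lambda X(p)\Lambda^\dagger$, where $X(p)=p^0I-\mathbf p\cdot\boldsymbol\sigma$ ($\boldsymbol\sigma$ the Pauli matrices). $L(p)$ is the standard boost: the positive definite Hermitian element of $SL(2,\mathbb{C})$ with $\lambda(L(p))k=p$. Representations. $D^{(s)}$ is the spin-$s$ irreducible representation of $SU(2)$ of dimension $2s+1$, unitary in its standard basis, extended holomorphically to $SL(2,\mathbb{C})$. $D^{AB}(\Lambda)=D^{(A)}(\Lambda)\otimes D^{(B)}((\Lambda^\dagger)^{-1})$ is the $(A,B)$ irreducible representation of $SL(2,\mathbb{C})$; its restriction to $SU(2)$ is unitary. Coefficient functions. $u^{AB}(\mathbf p)$ is the $(2A+1)(2B+1)\times(2j+1)$ matrix $u^{AB}(\mathbf p)=(m/p^0)^{1/2}D^{AB}(L(p))u^{AB}(\mathbf 0)$, where $u^{AB}(\mathbf 0)D^{(j)}(W)=D^{AB}(W)u^{AB}(\mathbf 0)$ for all $W\in SU(2)$ and $u^{AB}(\mathbf 0)^\dagger u^{AB}(\mathbf 0)=I$; similarly for $(C,D)$. Spin sum. For $p$ on the mass shell, $\pi^{AB,CD}(p)=\pi^{AB,CD}(\mathbf p)$ is the $(2A+1)(2B+1)\times(2C+1)(2D+1)$ matrix defined by $(2p^0)^{-1}\pi^{AB,CD}(\mathbf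 p)=u^{AB}(\mathbf p)u^{CD}(\mathbf p)^\dagger$. *)

theory Defs
  imports
    "HOL-Analysis.Finite_Cartesian_Product"
    "HOL-Computational_Algebra.Polynomial"
    "Jordan_Normal_Form.Matrix"
    "Jordan_Normal_Form.Determinant"
    "Jordan_Normal_Form.Gauss_Jordan_Elimination"
    "Jordan_Normal_Form.Schur_Decomposition"
begin

no_notation Matrix.vec_index (infixl \<open>$\<close> 100)

section \<open>Kinematics\<close>

text \<open>A 4-vector is a pair of its spatial part and its time component.\<close>

type_synonym four_vec = "(real ^ 3) \<times> real"

definition energy :: "real \<Rightarrow> real ^ 3 \<Rightarrow> real" where
  "energy m p = sqrt ((norm p)\<^sup>2 + m\<^sup>2)"

definition pauli1 :: "complex mat" where
  "pauli1 = mat_of_rows_list 2 [[0, 1], [1, 0]]"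

definition pauli2 :: "complex mat" where
  "pauli2 = mat_of_rows_list 2 [[0, - \<i>], [\<i>, 0]]"

definition pauli3 :: "complex mat" where
  "pauli3 = mat_of_rows_list 2 [[1, 0], [0, - 1]]"

definition X_mat :: "four_vec \<Rightarrow> complex mat" where
  "X_mat = (\<lambda>(p, p0). of_real p0 \<cdot>\<^sub>m 1\<^sub>m 2 -
     (of_real (p $ 1) \<cdot>\<^sub>m pauli1 + of_real (p $ 2) \<cdot>\<^sub>m pauli2 + of_real (p $ 3) \<cdot>\<^sub>m pauli3))"

definition SL2C :: "complex mat set" where
  "SL2C = {\<Lambda> \<in> carrier_mat 2 2. Determinant.det \<Lambda> = 1}"

definition SU2 :: "complex mat set" where
  "SU2 = {W \<in> SL2C. mat_adjoint W * W = 1\<^sub>m 2}"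

text \<open>
  The map X is injective, and for \<open>\<Lambda>\<close> in SL(2,C) the Hermitian matrix
  \<open>\<Lambda> X(p) \<Lambda>\<^sup>\<dagger>\<close> is in its range, so the description is definite.
\<close>

definition covering :: "complex mat \<Rightarrow> four_vec \<Rightarrow> four_vec" where
  "covering \<Lambda> p = (THE q. X_mat q = \<Lambda> * X_mat p * mat_adjoint \<Lambda>)"

definition positive_definite_hermitian :: "nat \<Rightarrow> complex mat \<Rightarrow> bool" where
  "positive_definite_hermitian n M \<longleftrightarrow> M \<in> carrier_mat n n \<and> mat_adjoint M = M \<and>
     (\<forall>v \<in> carrier_vec n. v \<noteq> 0\<^sub>v n \<longrightarrow> 0 < Re ((M *\<^sub>v v) \<bullet>c v))"

definition boost :: "real \<Rightarrow> real ^ 3 \<Rightarrow> complex mat" where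
  "boost m p = (THE L. L \<in> SL2C \<and> positive_definite_hermitian 2 L \<and>
     covering L (0, m) = (p, energy m p))"


section \<open>Representations\<close>

definition nonneg_half_integer :: "real \<Rightarrow> bool" where
  "nonneg_half_integer s \<longleftrightarrow> 2 * s \<in> \<nat>"

definition twice :: "real \<Rightarrow> nat" where
  "twice s = nat \<lfloor>2 * s\<rfloor>"

text \<open>
  The spin-s representation acts on the homogeneous polynomials of degree \<open>n = 2 s\<close> in
  \<open>x, y\<close> by the substitution \<open>x \<mapsto> \<Lambda>\<^sub>0\<^sub>0 x + \<Lambda>\<^sub>1\<^sub>0 y\<close>, \<open>y \<mapsto> \<Lambda>\<^sub>0\<^sub>1 x + \<Lambda>\<^sub>1\<^sub>1 y\<close>. Row and
  column index \<open>i\<close> stand for the standard basis vector with magnetic quantum number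
  \<open>s - i\<close>, which is \<open>x\<^bsup>n-i\<^esup> y\<^bsup>i\<^esup> / sqrt ((n-i)! i!)\<close>; this basis is orthonormal for the
  SU(2)-invariant inner product. Setting \<open>x = 1\<close> turns the matrix entries into coefficients
  of univariate polynomials. The entries are polynomials in the entries of \<open>\<Lambda>\<close>, which is the
  holomorphic extension from SU(2) to SL(2,C).
\<close>

definition spin_rep :: "real \<Rightarrow> complex mat \<Rightarrow> complex mat" where
  "spin_rep s \<Lambda> = (let n = twice s in mat (n + 1) (n + 1) (\<lambda>(k, i).
     of_real (sqrt (fact (n - k) * fact k) / sqrt (fact (n - i) * fact i)) *
     coeff ([:\<Lambda> $$ (0, 0), \<Lambda> $$ (1, 0):] ^ (n - i) * [:\<Lambda> $$ (0, 1), \<Lambda> $$ (1, 1):] ^ i) k))"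

definition kronecker :: "complex mat \<Rightarrow> complex mat \<Rightarrow> complex mat" where
  "kronecker M N = mat (dim_row M * dim_row N) (dim_col M * dim_col N) (\<lambda>(k, l).
     M $$ (k div dim_row N, l div dim_col N) * N $$ (k mod dim_row N, l mod dim_col N))"

definition AB_rep :: "real \<Rightarrow> real \<Rightarrow> complex mat \<Rightarrow> complex mat" where
  "AB_rep A B \<Lambda> = kronecker (spin_rep A \<Lambda>) (spin_rep B (the (mat_inverse (mat_adjoint \<Lambda>))))"

definition AB_dim :: "real \<Rightarrow> real \<Rightarrow> nat" where
  "AB_dim A B = (twice A + 1) * (twice B + 1)"


section \<open>Coefficient functions and spin sum\<close>

text \<open>
  The conditions determine \<open>u\<^sup>A\<^sup>B(0)\<close> only up to a phase, so it is a parameter of the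
  coefficient functions and of the spin sum.
\<close>

definition rest_coefficient :: "real \<Rightarrow> real \<Rightarrow> real \<Rightarrow> complex mat \<Rightarrow> bool" where
  "rest_coefficient A B j u0 \<longleftrightarrow> u0 \<in> carrier_mat (AB_dim A B) (twice j + 1) \<and>
     (\<forall>W \<in> SU2. u0 * spin_rep j W = AB_rep A B W * u0) \<and>
     mat_adjoint u0 * u0 = 1\<^sub>m (twice j + 1)"

definition coefficient_function ::
    "real \<Rightarrow> real \<Rightarrow> real \<Rightarrow> complex mat \<Rightarrow> real ^ 3 \<Rightarrow> complex mat" where
  "coefficient_function m A B u0 p =
     of_real (sqrt (m / energy m p)) \<cdot>\<^sub>m (AB_rep A B (boost m p) * u0)"

definition spin_sum ::
    "real \<Rightarrow> real \<Rightarrow> real \<Rightarrow> complex mat \<Rightarrow> real \<Rightarrow> real \<Rightarrow> complex mat \<Rightarrow> real ^ 3 \<Rightarrow> complex mat"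
  where
  "spin_sum m A B u0 C D v0 p = of_real (2 * energy m p) \<cdot>\<^sub>m
     (coefficient_function m A B u0 p * mat_adjoint (coefficient_function m C D v0 p))"


section \<open>Matrix-valued polynomials in four variables\<close>

text \<open>
  The sum of the matrices \<open>c (a, b, d, e)\<close> times the monomials is written entrywise: the type
  of matrices has no zero of its own, so it has no sums over finite sets.
\<close>

definition matrix_polynomial :: "nat \<Rightarrow> nat \<Rightarrow> (four_vec \<Rightarrow> complex mat) \<Rightarrow> bool" where
  "matrix_polynomial nr nc P \<longleftrightarrow>
     (\<exists>(S :: (nat \<times> nat \<times> nat \<times> nat) set) c. finite S \<and> (\<forall>\<alpha> \<in> S. c \<alpha> \<in> carrier_mat nr nc) \<and>
        (\<forall>p p0. P (p, p0) = mat nr nc (\<lambda>kl. \<Sum>(a, b, d, e) \<in> S.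
           of_real ((p $ 1) ^ a * (p $ 2) ^ b * (p $ 3) ^ d * p0 ^ e) * c (a, b, d, e) $$ kl)))"


section \<open>The spin-s representation is a representation, unitary on SU(2)\<close>

lemma spin_rep_carrier [simp]: "spin_rep s g \<in> carrier_mat (twice s + 1) (twice s + 1)"
  by (simp add: spin_rep_def Let_def)

text \<open>The value at \<open>(u, v)\<close> of the degree-\<open>n\<close> homogenization of \<open>f\<close>.\<close>

definition hom_subst :: "nat \<Rightarrow> complex poly \<Rightarrow> complex poly \<Rightarrow> complex poly \<Rightarrow> complex poly" where
  "hom_subst n u v f = (\<Sum>k\<le>n. smult (coeff f k) (u ^ (n - k) * v ^ k))"

lemma hom_subst_linear:
  assumes "degree f \<le> n"
  shows "hom_subst (Suc n) u v (f * [:a, b:]) = hom_subst n u v f * (smult a u + smult b v)"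
proof -
  have c: "coeff (f * [:a, b:]) k = a * coeff f k + (case k of 0 \<Rightarrow> 0 | Suc l \<Rightarrow> b * coeff f l)" for k
    by (simp add: mult_pCons_right coeff_pCons split: nat.splits)
  have 1: "(\<Sum>k\<le>Suc n. smult (a * coeff f k) (u ^ (Suc n - k) * v ^ k))
      = (\<Sum>k\<le>n. smult (coeff f k) (u ^ (n - k) * v ^ k)) * smult a u"
    using assms by (simp add: coeff_eq_0 sum_distrib_left smult_sum2 Suc_diff_le mult_ac)
  have 2: "(\<Sum>k\<le>Suc n. smult (case k of 0 \<Rightarrow> 0 | Suc l \<Rightarrow> b * coeff f l) (u ^ (Suc n - k) * v ^ k))
      = (\<Sum>k\<le>n. smult (coeff f k) (u ^ (n - k) * v ^ k)) * smult b v"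
    by (subst sum.atMost_Suc_shift) (simp add: sum_distrib_left smult_sum2 mult_ac)
  show ?thesis
    unfolding hom_subst_def c smult_add_left sum.distrib distrib_left 1 2 ..
qed

lemma degree_linear_powers:
  "degree ([:a, b:] ^ i * [:c, d:] ^ l :: complex poly) \<le> i + l"
proof -
  have "degree ([:x, y:] ^ k :: complex poly) \<le> k" for x y k
    using degree_power_le[of "[:x, y:]" k] by (auto split: if_splits)
  then show ?thesis by (meson add_mono degree_mult_le order_trans)
qed

lemma hom_subst_powers:
  "hom_subst (i + l) u v ([:a, b:] ^ i * [:c, d:] ^ l)
     = (smult a u + smult b v) ^ i * (smult c u + smult d v) ^ l"
proof (induction l)
  case 0
  show ?case
  proof (induction i)
    case 0
    then show ?case by (simp add: hom_subst_def)
  next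
    case (Suc i)
    have "hom_subst (Suc i) u v ([:a, b:] ^ i * [:a, b:]) = (smult a u + smult b v) ^ i * (smult a u + smult b v)"
      using Suc hom_subst_linear[of "[:a, b:] ^ i" i] degree_linear_powers[of a b i 0 0 0] by simp
    then show ?case by (simp add: mult_ac)
  qed
next
  case (Suc l)
  have "[:a, b:] ^ i * [:c, d:] ^ Suc l = [:a, b:] ^ i * [:c, d:] ^ l * [:c, d:]"
    by (simp only: power_Suc2 mult.assoc)
  then show ?case
    using Suc hom_subst_linear[of "[:a, b:] ^ i * [:c, d:] ^ l" "i + l" u v c d] degree_linear_powers[of a b i c d l]
    by (simp only: add_Suc_right power_Suc2 mult.assoc)
qed

lemma spin_rep_mult:
  assumes "g \<in> carrier_mat 2 2" "h \<in> carrier_mat 2 2"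
  shows "spin_rep s (g * h) = spin_rep s g * spin_rep s h"
proof (rule eq_matI)
  let ?n = "twice s"
  let ?u = "[:g $$ (0, 0), g $$ (1, 0):]" and ?v = "[:g $$ (0, 1), g $$ (1, 1):]"
  fix k i assume "k < dim_row (spin_rep s g * spin_rep s h)" "i < dim_col (spin_rep s g * spin_rep s h)"
  then have ki: "k \<le> ?n" "i \<le> ?n" by (auto simp: spin_rep_def Let_def)
  define w where "w k = complex_of_real (sqrt (fact (?n - k) * fact k))" for k
  have w0: "w k \<noteq> 0" for k by (simp add: w_def)
  define f where "f = [:h $$ (0, 0), h $$ (1, 0):] ^ (?n - i) * [:h $$ (0, 1), h $$ (1, 1):] ^ i"
  have e: "(g * h) $$ (x, y) = g $$ (x, 0) * h $$ (0, y) + g $$ (x, 1) * h $$ (1, y)"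
    if "x < 2" "y < 2" for x y
    using assms that by (auto simp: scalar_prod_def numeral_2_eq_2)
  have p: "[:(g * h) $$ (0, y), (g * h) $$ (1, y):] = smult (h $$ (0, y)) ?u + smult (h $$ (1, y)) ?v"
    if "y < 2" for y using that by (simp add: e mult_ac)
  have two: "(0::nat) < 2" "(1::nat) < 2" by auto
  note p0 = p[OF two(1)] and p1 = p[OF two(2)]
  have "spin_rep s (g * h) $$ (k, i) = w k / w i * coeff (hom_subst ?n ?u ?v f) k"
  proof -
    have "hom_subst ?n ?u ?v f = [:(g * h) $$ (0, 0), (g * h) $$ (1, 0):] ^ (?n - i) *
        [:(g * h) $$ (0, 1), (g * h) $$ (1, 1):] ^ i"
      using ki hom_subst_powers[of "?n - i" i ?u ?v]
      unfolding f_def p0 p1 by simp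
    then show ?thesis using ki by (simp add: spin_rep_def Let_def w_def)
  qed
  also have "\<dots> = (\<Sum>l\<le>?n. w k / w i * (coeff f l * coeff (?u ^ (?n - l) * ?v ^ l) k))"
    by (simp add: hom_subst_def coeff_sum sum_distrib_left)
  also have "\<dots> = (\<Sum>l\<le>?n. spin_rep s g $$ (k, l) * spin_rep s h $$ (l, i))"
    using ki w0 by (intro sum.cong refl) (simp add: spin_rep_def Let_def w_def[symmetric] f_def)
  also have "\<dots> = (spin_rep s g * spin_rep s h) $$ (k, i)"
    using ki by (simp add: spin_rep_def Let_def scalar_prod_def atLeast0LessThan lessThan_Suc_atMost)
  finally show "spin_rep s (g * h) $$ (k, i) = (spin_rep s g * spin_rep s h) $$ (k, i)" .
qed (auto simp: spin_rep_def Let_def)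


lemma coeff_two_powers:
  fixes a b c d :: complex
  assumes "k \<le> n" "i \<le> n"
  shows "coeff ([:a, c:] ^ (n - i) * [:b, d:] ^ i) k = fact (n - i) * fact i *
    (\<Sum>r | r \<le> k \<and> r \<le> i \<and> k + i \<le> n + r.
       a ^ (n + r - (k + i)) * c ^ (k - r) * b ^ (i - r) * d ^ r /
       (fact (n + r - (k + i)) * fact (k - r) * fact (i - r) * fact r))"
proof -
  have "coeff ([:a, c:] ^ (n - i) * [:b, d:] ^ i) k
      = (\<Sum>r\<le>k. coeff ([:b, d:] ^ i) r * coeff ([:a, c:] ^ (n - i)) (k - r))"
    by (subst mult.commute) (rule coeff_mult)
  also have "\<dots> = (\<Sum>r | r \<le> k \<and> r \<le> i \<and> k + i \<le> n + r.
      coeff ([:b, d:] ^ i) r * coeff ([:a, c:] ^ (n - i)) (k - r))"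
  proof (rule sum.mono_neutral_right)
    show "\<forall>r\<in>{..k} - {r. r \<le> k \<and> r \<le> i \<and> k + i \<le> n + r}.
       coeff ([:b, d:] ^ i) r * coeff ([:a, c:] ^ (n - i)) (k - r) = 0"
    proof
      fix r assume "r \<in> {..k} - {r. r \<le> k \<and> r \<le> i \<and> k + i \<le> n + r}"
      then consider "i < r" | "n - i < k - r" using assms by fastforce
      then show "coeff ([:b, d:] ^ i) r * coeff ([:a, c:] ^ (n - i)) (k - r) = 0"
        by cases (use degree_linear_powers[of b d i 0 0 0] degree_linear_powers[of a c "n - i" 0 0 0]
          in \<open>auto intro!: coeff_eq_0 elim: le_less_trans\<close>)
    qed
  qed auto
  also have "\<dots> = (\<Sum>r | r \<le> k \<and> r \<le> i \<and> k + i \<le> n + r. fact (n - i) * fact i *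
       (a ^ (n + r - (k + i)) * c ^ (k - r) * b ^ (i - r) * d ^ r /
       (fact (n + r - (k + i)) * fact (k - r) * fact (i - r) * fact r)))"
  proof (rule sum.cong[OF refl])
    fix r assume "r \<in> {r. r \<le> k \<and> r \<le> i \<and> k + i \<le> n + r}"
    then have r: "r \<le> i" "k - r \<le> n - i" and e: "n - i - (k - r) = n + r - (k + i)"
      using assms by auto
    show "coeff ([:b, d:] ^ i) r * coeff ([:a, c:] ^ (n - i)) (k - r) = fact (n - i) * fact i *
       (a ^ (n + r - (k + i)) * c ^ (k - r) * b ^ (i - r) * d ^ r /
       (fact (n + r - (k + i)) * fact (k - r) * fact (i - r) * fact r))"
      by (simp add: coeff_linear_poly_power[OF r(1)] coeff_linear_poly_power[OF r(2)]
        binomial_fact[OF r(1)] binomial_fact[OF r(2)] e mult_ac del: diff_diff_left)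
  qed
  finally show ?thesis by (simp add: sum_distrib_left)
qed

lemma mat_adjoint_index:
  "i < dim_col M \<Longrightarrow> k < dim_row M \<Longrightarrow> mat_adjoint M $$ (i, k) = cnj (M $$ (k, i))"
  by (simp add: mat_adjoint_def mat_of_rows_def)

lemma spin_rep_entry:
  assumes "k \<le> twice s" "i \<le> twice s"
  shows "spin_rep s g $$ (k, i) =
    of_real (sqrt (fact (twice s - k) * fact k) * sqrt (fact (twice s - i) * fact i)) *
    (\<Sum>r | r \<le> k \<and> r \<le> i \<and> k + i \<le> twice s + r.
       g $$ (0, 0) ^ (twice s + r - (k + i)) * g $$ (1, 0) ^ (k - r) * g $$ (0, 1) ^ (i - r) * g $$ (1, 1) ^ r /
       (fact (twice s + r - (k + i)) * fact (k - r) * fact (i - r) * fact r))"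
proof -
  define q where "q = (fact (twice s - i) * fact i :: real)"
  have q: "q > 0" by (simp add: q_def)
  have "complex_of_real (x / sqrt q) * (of_real q * z) = of_real (x * sqrt q) * z" for x z
  proof -
    have "complex_of_real (x / sqrt q) * (of_real q * z) = of_real (x * (q / sqrt q)) * z"
      by simp
    also have "q / sqrt q = sqrt q" using q by (simp add: real_div_sqrt)
    finally show ?thesis .
  qed
  moreover have "fact (twice s - i) * fact i = complex_of_real q" by (simp add: q_def)
  ultimately show ?thesis
    using assms unfolding spin_rep_def Let_def
    by (simp only: coeff_two_powers index_mat(1) case_prod_conv q_def[symmetric] less_Suc_eq_le Suc_eq_plus1[symmetric])
qed

lemma spin_rep_adjoint:
  assumes "g \<in> carrier_mat 2 2"
  shows "spin_rep s (mat_adjoint g) = mat_adjoint (spin_rep s g)"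
proof (rule eq_matI)
  fix k i assume "k < dim_row (mat_adjoint (spin_rep s g))" "i < dim_col (mat_adjoint (spin_rep s g))"
  then have ki: "k \<le> twice s" "i \<le> twice s" by (auto simp: spin_rep_def Let_def mat_adjoint_def)
  have a: "mat_adjoint g $$ (x, y) = cnj (g $$ (y, x))" if "x < 2" "y < 2" for x y
    using assms that by (simp add: mat_adjoint_index)
  have "spin_rep s (mat_adjoint g) $$ (k, i) = cnj (spin_rep s g $$ (i, k))"
    unfolding spin_rep_entry[OF ki] spin_rep_entry[OF ki(2,1)]
    by (simp add: a ac_simps conj_commute conj_left_commute)
  also have "\<dots> = mat_adjoint (spin_rep s g) $$ (k, i)"
    using ki by (subst mat_adjoint_index) (auto simp: spin_rep_def Let_def)
  finally show "spin_rep s (mat_adjoint g) $$ (k, i) = mat_adjoint (spin_rep s g) $$ (k, i)" .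
qed (auto simp: spin_rep_def Let_def mat_adjoint_def)

lemma spin_rep_one: "spin_rep s (1\<^sub>m 2) = 1\<^sub>m (twice s + 1)"
proof (rule eq_matI)
  fix k i assume "k < dim_row (1\<^sub>m (twice s + 1))" "i < dim_col (1\<^sub>m (twice s + 1))"
  moreover have "[:0, 1:] ^ i = monom (1::complex) i" by (simp add: monom_altdef)
  ultimately show "spin_rep s (1\<^sub>m 2) $$ (k, i) = 1\<^sub>m (twice s + 1) $$ (k, i)"
    by (simp add: spin_rep_def Let_def one_pCons[symmetric])
qed (auto simp: spin_rep_def Let_def)

lemma spin_rep_unitary:
  assumes "W \<in> SU2"
  shows "mat_adjoint (spin_rep s W) * spin_rep s W = 1\<^sub>m (twice s + 1)"
proof -
  have W: "W \<in> carrier_mat 2 2" "mat_adjoint W * W = 1\<^sub>m 2"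
    using assms by (auto simp: SU2_def SL2C_def)
  then have "mat_adjoint W \<in> carrier_mat 2 2" by (auto simp: mat_adjoint_def)
  then show ?thesis
    using W by (metis spin_rep_adjoint spin_rep_mult spin_rep_one)
qed

end

theory Submission
  imports Defs "HOL-Analysis.Cartesian_Space"
begin

text \<open>
  Write \<open>M = u\<^sup>A\<^sup>B(0) u\<^sup>C\<^sup>D(0)\<^sup>\<dagger>\<close> and \<open>L = L(p)\<close>. The spin sum is \<open>2m\<close> times
  \<open>(D\<^sup>A(L) \<otimes> D\<^sup>B(L\<^sup>-\<^sup>1)) M (D\<^sup>C(L) \<otimes> D\<^sup>D(L\<^sup>-\<^sup>1))\<close>. The relation
  \<open>M (D\<^sup>C(W) \<otimes> D\<^sup>D(W)) = (D\<^sup>A(W) \<otimes> D\<^sup>B(W)) M\<close> extends from SU(2) to \<open>L\<close>: diagonalize \<open>L\<close> by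
  a matrix in SU(2) and compare torus weights. Hence the spin sum equals
  \<open>2m (D\<^sup>A(L\<^sup>2) \<otimes> 1) M (1 \<otimes> D\<^sup>D(L\<^sup>-\<^sup>2))\<close>, where \<open>L\<^sup>2 = X(\<^bold>p, p\<^sup>0)/m\<close> and
  \<open>L\<^sup>-\<^sup>2 = X(-\<^bold>p, p\<^sup>0)/m\<close>. This is a polynomial, homogeneous of degree \<open>2A + 2D\<close>.
\<close>

section \<open>Two-by-two matrices and the boost\<close>

text \<open>Literal entries turn every 2x2 matrix identity into complex arithmetic on four
  numbers.\<close>

definition mat2 :: "complex \<Rightarrow> complex \<Rightarrow> complex \<Rightarrow> complex \<Rightarrow> complex mat" where
  "mat2 a b c d = mat_of_rows_list 2 [[a, b], [c, d]]"

lemma mat2_carrier [simp]: "mat2 a b c d \<in> carrier_mat 2 2"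
  by (auto simp: mat2_def mat_of_rows_list_def)

lemma mat2_dim [simp]: "dim_row (mat2 a b c d) = 2" "dim_col (mat2 a b c d) = 2"
  by (simp_all add: mat2_def mat_of_rows_list_def)

lemma mat2_index [simp]:
  "mat2 a b c d $$ (0, 0) = a" "mat2 a b c d $$ (0, Suc 0) = b"
  "mat2 a b c d $$ (Suc 0, 0) = c" "mat2 a b c d $$ (Suc 0, Suc 0) = d"
  by (simp_all add: mat2_def mat_of_rows_list_def)

lemma mat2_eqI:
  assumes "M \<in> carrier_mat 2 2"
    and "M $$ (0, 0) = a" "M $$ (0, 1) = b" "M $$ (1, 0) = c" "M $$ (1, 1) = d"
  shows "M = mat2 a b c d"
  using assms by (intro eq_matI) (auto simp: less_2_cases_iff)

lemma mat2_cases: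
  assumes "M \<in> carrier_mat 2 2"
  obtains a b c d where "M = mat2 a b c d"
  using mat2_eqI[OF assms] by blast

lemma mat2_eq_iff [simp]:
  "mat2 a b c d = mat2 a' b' c' d' \<longleftrightarrow> a = a' \<and> b = b' \<and> c = c' \<and> d = d'"
  by (metis mat2_index)

lemma mat2_mult [simp]:
  "mat2 a b c d * mat2 a' b' c' d' =
    mat2 (a * a' + b * c') (a * b' + b * d') (c * a' + d * c') (c * b' + d * d')"
  by (rule mat2_eqI) (auto simp: scalar_prod_def numeral_2_eq_2)

lemma mat2_add [simp]:
  "mat2 a b c d + mat2 a' b' c' d' = mat2 (a + a') (b + b') (c + c') (d + d')"
  by (rule mat2_eqI) auto

lemma mat2_diff [simp]:
  "mat2 a b c d - mat2 a' b' c' d' = mat2 (a - a') (b - b') (c - c') (d - d')"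
  by (rule mat2_eqI) auto

lemma mat2_smult [simp]: "x \<cdot>\<^sub>m mat2 a b c d = mat2 (x * a) (x * b) (x * c) (x * d)"
  by (rule mat2_eqI) auto

lemma one_mat2: "1\<^sub>m 2 = mat2 1 0 0 1"
  by (rule mat2_eqI) auto

lemma mat2_adjoint [simp]: "mat_adjoint (mat2 a b c d) = mat2 (cnj a) (cnj c) (cnj b) (cnj d)"
  by (rule mat2_eqI) (auto simp: mat_adjoint_index, auto simp: mat_adjoint_def)

lemma mat2_det [simp]: "Determinant.det (mat2 a b c d) = a * d - b * c"
proof -
  have "Determinant.det (mat2 a b c d) =
      (\<Sum>i<2. mat2 a b c d $$ (i, 0) * cofactor (mat2 a b c d) i 0)"
    by (rule laplace_expansion_column) auto
  also have "\<dots> = a * d - b * c"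
    by (simp add: cofactor_def numeral_2_eq_2 mat_delete_def det_single)
  finally show ?thesis .
qed

section \<open>The Hermitian matrices \<open>X_mat\<close> and the covering map\<close>

lemma X_mat_eq:
  "X_mat (p, p0) = mat2 (p0 - p $ 3) (Complex (- (p $ 1)) (p $ 2))
     (Complex (- (p $ 1)) (- (p $ 2))) (p0 + p $ 3)"
  by (simp add: X_mat_def pauli1_def pauli2_def pauli3_def mat2_def[symmetric] one_mat2 complex_eq_iff)

lemma X_mat_inj: "X_mat p = X_mat q \<longleftrightarrow> p = q"
proof
  obtain a a0 b b0 where pq: "p = (a, a0)" "q = (b, b0)" by fastforce
  assume "X_mat p = X_mat q"
  then have "a0 - a $ 3 = b0 - b $ 3" "a0 + a $ 3 = b0 + b $ 3" "a $ 1 = b $ 1" "a $ 2 = b $ 2"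
    by (auto simp: X_mat_eq pq complex_eq_iff)
  then have "a $ 3 = b $ 3" "a0 = b0" by linarith+
  with \<open>a $ 1 = b $ 1\<close> \<open>a $ 2 = b $ 2\<close> show "p = q"
    by (simp add: pq Finite_Cartesian_Product.vec_eq_iff forall_3)
qed simp

lemma energy_sq: "(energy m p)\<^sup>2 = (p $ 1)\<^sup>2 + (p $ 2)\<^sup>2 + (p $ 3)\<^sup>2 + m\<^sup>2"
  by (simp add: energy_def norm_vec_def L2_set_def sum_3)

lemma of_real_cmod_square: "(complex_of_real (cmod z))\<^sup>2 = z * cnj z"
  by (metis complex_norm_square of_real_power)

lemma hermitian_mat2:
  assumes "L \<in> carrier_mat 2 2" "mat_adjoint L = L"
  obtains a d :: real and b where "L = mat2 a b (cnj b) d"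
proof -
  obtain a b c d where L: "L = mat2 a b c d" using assms(1) by (rule mat2_cases)
  with assms(2) have "cnj a = a" "cnj d = d" "cnj b = c" by auto
  then have "L = mat2 (of_real (Re a)) b (cnj b) (of_real (Re d))"
    by (simp add: L Reals_cnj_iff)
  then show thesis by (rule that)
qed

text \<open>Together with \<open>X_mat_inj\<close> this makes the description in
  \<open>covering\<close> definite.\<close>

lemma X_mat_range:
  assumes "M \<in> carrier_mat 2 2" "mat_adjoint M = M"
  shows "\<exists>q. X_mat q = M"
proof -
  obtain a d :: real and b where M: "M = mat2 a b (cnj b) d"
    using assms by (rule hermitian_mat2)
  \<comment> \<open>Solves \<open>a = p0 - p3\<close>, \<open>d = p0 + p3\<close> and
    \<open>b = - p1 + i p2\<close>; hence \<open>p0 = (a + d) / 2\<close>.\<close>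
  define p :: "real ^ 3" where
    "p = (\<chi> i. if i = 1 then - Re b else if i = 2 then Im b else (d - a) / 2)"
  have "X_mat (p, (a + d) / 2) = M"
    by (simp add: M X_mat_eq p_def complex_eq_iff field_simps)
  then show ?thesis by blast
qed

lemma X_mat_covering:
  assumes "\<Lambda> \<in> carrier_mat 2 2"
  shows "X_mat (covering \<Lambda> q) = \<Lambda> * X_mat q * mat_adjoint \<Lambda>"
proof -
  obtain a b c d where \<Lambda>: "\<Lambda> = mat2 a b c d" using assms by (rule mat2_cases)
  obtain p p0 where q: "q = (p, p0)" by fastforce
  have "\<exists>r. X_mat r = \<Lambda> * X_mat q * mat_adjoint \<Lambda>"
    by (rule X_mat_range) (auto simp: \<Lambda> q X_mat_eq complex_eq_iff algebra_simps)
  then have "\<exists>!r. X_mat r = \<Lambda> * X_mat q * mat_adjoint \<Lambda>"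
    by (metis X_mat_inj)
  then show ?thesis unfolding covering_def by (rule theI')
qed

text \<open>\<open>X_mat (0, m)\<close> is \<open>m\<close> times the identity. Finding the boost
  thus becomes extracting a square root of \<open>X_mat (p, energy m p)\<close> divided by
  \<open>m\<close>.\<close>

lemma covering_rest:
  assumes "L \<in> carrier_mat 2 2" "mat_adjoint L = L"
  shows "covering L (0, m) = q \<longleftrightarrow> complex_of_real m \<cdot>\<^sub>m (L * L) = X_mat q"
proof -
  have "L * X_mat (0, m) * mat_adjoint L = complex_of_real m \<cdot>\<^sub>m (L * L)"
    using assms(1) unfolding assms(2)
    by (rule mat2_cases) (simp add: X_mat_eq algebra_simps Complex_eq)
  then show ?thesis
    using X_mat_covering[OF assms(1)] X_mat_inj by metis
qed

section \<open>Positive definite matrices of determinant 1 and the boost\<close>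

lemma positive_definite_mat2_iff:
  fixes a d :: real
  assumes det: "a * d - (cmod b)\<^sup>2 = 1"
  shows "positive_definite_hermitian 2 (mat2 a b (cnj b) d) \<longleftrightarrow> a > 0 \<and> d > 0"
proof
  let ?L = "mat2 a b (cnj b) d"
  have form: "Re ((?L *\<^sub>v v) \<bullet>c v) = a * (cmod x)\<^sup>2 + d * (cmod y)\<^sup>2 + 2 * Re (b * y * cnj x)"
    if v: "v \<in> carrier_vec 2" "x = vec_index v 0" "y = vec_index v 1" for v x y
  proof -
    have "(?L *\<^sub>v v) \<bullet>c v = (a * x + b * y) * cnj x + (cnj b * x + d * y) * cnj y"
      using v by (simp add: scalar_prod_def numeral_2_eq_2)
    then show ?thesis
      unfolding cmod_power2 by (simp add: algebra_simps power2_eq_square)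
  qed
  {
    assume pd: "positive_definite_hermitian 2 ?L"
    \<comment> \<open>The form at the two unit vectors gives the diagonal entries.\<close>
    have "0 < Re ((?L *\<^sub>v unit_vec 2 i) \<bullet>c unit_vec 2 i)" if "i < 2" for i
    proof -
      have "unit_vec 2 i \<noteq> (0\<^sub>v 2 :: complex vec)"
        using that by (metis index_unit_vec(1) index_zero_vec(1) zero_neq_one)
      then show ?thesis using pd by (simp add: positive_definite_hermitian_def)
    qed
    from this[of 0] this[of 1] show "a > 0 \<and> d > 0"
      by (simp_all add: form[OF _ refl refl])
  }
  {
    assume pos: "a > 0 \<and> d > 0"
    have "0 < Re ((?L *\<^sub>v v) \<bullet>c v)" if v: "v \<in> carrier_vec 2" "v \<noteq> 0\<^sub>v 2" for v
    proof -
      define x y where "x = vec_index v 0" and "y = vec_index v 1"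
      have "x \<noteq> 0 \<or> y \<noteq> 0"
        using v by (auto simp: x_def y_def less_2_cases_iff)
      \<comment> \<open>Completing the square after multiplying the form by \<open>a\<close>; the
        leftover coefficient of \<open>(cmod y)^2\<close> is the determinant.\<close>
      have "a * (a * (cmod x)\<^sup>2 + d * (cmod y)\<^sup>2 + 2 * Re (b * y * cnj x))
          = (cmod (a * x + b * y))\<^sup>2 + (a * d - (cmod b)\<^sup>2) * (cmod y)\<^sup>2"
        unfolding cmod_power2 by (simp add: algebra_simps power2_eq_square)
      also have "\<dots> = (cmod (a * x + b * y))\<^sup>2 + (cmod y)\<^sup>2" by (simp add: det)
      also have "\<dots> > 0"
      proof (cases "y = 0")
        case True
        then show ?thesis using pos \<open>x \<noteq> 0 \<or> y \<noteq> 0\<close> by simp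
      qed (simp add: add_nonneg_pos)
      finally show ?thesis
        using pos by (simp add: form[OF v(1) x_def y_def] zero_less_mult_iff)
    qed
    then show "positive_definite_hermitian 2 ?L"
      by (simp add: positive_definite_hermitian_def)
  }
qed

text \<open>
  By Cayley-Hamilton, a positive square root \<open>L\<close> of \<open>X(p)/m\<close> of determinant 1 and trace \<open>t\<close>
  satisfies \<open>t L = L\<^sup>2 + 1\<close>, so it is explicit and unique.
\<close>

lemma boost_square_unique:
  assumes m: "m > 0"
  shows "\<exists>!L. L \<in> SL2C \<and> positive_definite_hermitian 2 L \<and>
    complex_of_real m \<cdot>\<^sub>m (L * L) = X_mat (p, energy m p)"
proof -
  define E where "E = energy m p"
  \<comment> \<open>The trace of the root: taking traces in \<open>t L = X / m + 1\<close> gives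
    \<open>t^2 = 2 E / m + 2\<close>.\<close>
  define t where "t = sqrt ((2 * E + 2 * m) / m)"
  define x where "x = E - p $ 3"
  define w where "w = E + p $ 3"
  define y where "y = Complex (- (p $ 1)) (p $ 2)"
  have X: "X_mat (p, E) = mat2 x y (cnj y) w"
    by (simp add: X_mat_eq x_def y_def w_def complex_eq_iff)
  have "E \<ge> 0" by (simp add: E_def energy_def)
  then have t: "t > 0" "m * t\<^sup>2 = x + w + 2 * m"
    using m by (simp_all add: t_def x_def w_def)
  have det: "x * w - (cmod y)\<^sup>2 = m\<^sup>2"
    using energy_sq[of m p] unfolding E_def[symmetric]
    unfolding cmod_power2 by (simp add: x_def w_def y_def algebra_simps power2_eq_square)
  \<comment> \<open>The mass shell bounds the third component by \<open>E\<close>, so the diagonal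
    of \<open>X\<close> is non-negative; this is what makes \<open>a\<close> and \<open>d\<close>
    positive.\<close>
  have "\<bar>p $ 3\<bar> \<le> E"
    using \<open>E \<ge> 0\<close> energy_sq[of m p] unfolding E_def[symmetric]
    by (intro abs_le_square_iff[THEN iffD2, of _ E, simplified \<open>E \<ge> 0\<close> abs_of_nonneg]) simp
  then have xw: "x \<ge> 0" "w \<ge> 0" by (auto simp: x_def w_def)
  \<comment> \<open>\<open>a\<close>, \<open>b\<close>, \<open>d\<close> are the entries of
    \<open>(X + m) / (m t)\<close>, the solution of the Cayley-Hamilton relation for
    \<open>L\<close>.\<close>
  define a where "a = (x + m) / (m * t)"
  define d where "d = (w + m) / (m * t)"
  define b where "b = y / (m * t)"
  have ad: "a > 0" "d > 0" using xw m t by (simp_all add: a_def d_def add_nonneg_pos)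
  have tr: "a + d = t"
  proof -
    have "a + d = (x + w + 2 * m) / (m * t)"
      by (simp add: a_def d_def add_divide_distrib)
    also have "\<dots> = t"
      unfolding t(2)[symmetric] using m t(1) by (simp add: power2_eq_square)
    finally show ?thesis .
  qed
  have d1: "a * d - (cmod b)\<^sup>2 = 1"
  proof -
    have "a * d - (cmod b)\<^sup>2 = ((x + m) * (w + m) - (cmod y)\<^sup>2) / (m * t)\<^sup>2"
      using m t by (simp add: a_def d_def b_def norm_divide norm_mult power_divide diff_divide_distrib power2_eq_square)
    also have "(x + m) * (w + m) - (cmod y)\<^sup>2 = m * (m * t\<^sup>2)"
      unfolding t(2) using det by (simp add: algebra_simps power2_eq_square)
    finally show ?thesis using m t by (simp add: power2_eq_square)
  qed
  show ?thesis unfolding E_def[symmetric]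
  proof (rule ex1I[of _ "mat2 a b (cnj b) d"])
    \<comment> \<open>The determinant condition trades \<open>(cmod b)^2\<close> for
      \<open>a * d - 1\<close>, so the diagonal entry of the square becomes
      \<open>a * (a + d) - 1\<close> with the trace known.\<close>
    have 1: "complex_of_real (m * (a * a + (cmod b)\<^sup>2)) = x"
    proof -
      have "m * (a * a + (cmod b)\<^sup>2) = m * (a * (a + d) - 1)" using d1 by (simp add: algebra_simps)
      also have "\<dots> = x" unfolding tr using m t by (simp add: a_def field_simps)
      finally show ?thesis by simp
    qed
    have 2: "complex_of_real (m * (d * d + (cmod b)\<^sup>2)) = w"
    proof -
      have "m * (d * d + (cmod b)\<^sup>2) = m * (d * (a + d) - 1)" using d1 by (simp add: algebra_simps)
      also have "\<dots> = w" unfolding tr using m t by (simp add: d_def field_simps)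
      finally show ?thesis by simp
    qed
    have 3: "m * (a + d) * b = y"
      unfolding tr using m t by (simp add: b_def)
    then have 4: "m * (a + d) * cnj b = cnj y"
      by (metis complex_cnj_complex_of_real complex_cnj_mult)
    have "complex_of_real m \<cdot>\<^sub>m (mat2 a b (cnj b) d * mat2 a b (cnj b) d) = X_mat (p, E)"
      using 1 2 3 4 unfolding X by (simp add: algebra_simps of_real_cmod_square)
    moreover have "complex_of_real (a * d - (cmod b)\<^sup>2) = 1" by (simp only: d1 of_real_1)
    ultimately show "mat2 a b (cnj b) d \<in> SL2C \<and> positive_definite_hermitian 2 (mat2 a b (cnj b) d) \<and>
        complex_of_real m \<cdot>\<^sub>m (mat2 a b (cnj b) d * mat2 a b (cnj b) d) = X_mat (p, E)"
      using ad positive_definite_mat2_iff[OF d1] by (simp add: SL2C_def of_real_cmod_square)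
  next
    fix L
    assume L: "L \<in> SL2C \<and> positive_definite_hermitian 2 L \<and>
      complex_of_real m \<cdot>\<^sub>m (L * L) = X_mat (p, E)"
    then obtain a' d' :: real and b' where L': "L = mat2 a' b' (cnj b') d'"
      by (auto simp: positive_definite_hermitian_def elim: hermitian_mat2)
    have "complex_of_real (a' * d' - (cmod b')\<^sup>2) = 1"
      using L by (simp add: L' SL2C_def of_real_cmod_square)
    then have d1': "a' * d' - (cmod b')\<^sup>2 = 1" using of_real_eq_1_iff by blast
    then have pos: "a' > 0" "d' > 0" using L positive_definite_mat2_iff L' by auto
    have "complex_of_real (m * (a' * a' + (cmod b')\<^sup>2)) = of_real x"
      "complex_of_real (m * (d' * d' + (cmod b')\<^sup>2)) = of_real w"
      and e3: "complex_of_real (m * (a' + d')) * b' = y"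
      using L by (simp_all add: L' X of_real_cmod_square algebra_simps)
    then have e: "m * (a' * a' + (cmod b')\<^sup>2) = x" "m * (d' * d' + (cmod b')\<^sup>2) = w"
      using of_real_eq_iff by blast+
    \<comment> \<open>The trace of the square and the determinant fix the square of the trace, and
      positivity fixes its sign. With the trace known, the equations for the entries are
      linear.\<close>
    have "m * (a' + d')\<^sup>2 = m * t\<^sup>2"
      unfolding t(2) e[symmetric] using d1' by (simp add: algebra_simps power2_eq_square)
    then have "(a' + d')\<^sup>2 = t\<^sup>2" using m by simp
    then have t': "a' + d' = t" using t(1) pos by simp
    have "m * (a' * (a' + d')) = x + m" "m * (d' * (a' + d')) = w + m"
      unfolding e[symmetric] using d1' by (simp_all add: algebra_simps)
    then have "a' = a" "d' = d" unfolding t' using m t by (simp_all add: a_def d_def field_simps)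
    moreover have "b' = b" using e3 unfolding t' using m t by (simp add: b_def field_simps)
    ultimately show "L = mat2 a b (cnj b) d" by (simp add: L')
  qed
qed

text \<open>By \<open>covering_rest\<close> the description in \<open>boost\<close> is equivalent to
  the square-root problem, whose solution is unique.\<close>

lemma boost_properties:
  assumes "m > 0"
  shows "boost m p \<in> SL2C" "mat_adjoint (boost m p) = boost m p"
    "complex_of_real m \<cdot>\<^sub>m (boost m p * boost m p) = X_mat (p, energy m p)"
proof -
  have "(L \<in> SL2C \<and> positive_definite_hermitian 2 L \<and> covering L (0, m) = (p, energy m p))
      \<longleftrightarrow> (L \<in> SL2C \<and> positive_definite_hermitian 2 L \<and>
        complex_of_real m \<cdot>\<^sub>m (L * L) = X_mat (p, energy m p))" for L
    by (auto simp: positive_definite_hermitian_def covering_rest)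
  then have "boost m p \<in> SL2C \<and> positive_definite_hermitian 2 (boost m p) \<and>
      complex_of_real m \<cdot>\<^sub>m (boost m p * boost m p) = X_mat (p, energy m p)"
    using theI'[OF boost_square_unique[OF assms, of p]] unfolding boost_def by simp
  then show "boost m p \<in> SL2C" "mat_adjoint (boost m p) = boost m p"
    "complex_of_real m \<cdot>\<^sub>m (boost m p * boost m p) = X_mat (p, energy m p)"
    by (auto simp: positive_definite_hermitian_def)
qed

section \<open>Adjoints, inverses and Kronecker products\<close>

lemma mat_adjoint_dim [simp]:
  "dim_row (mat_adjoint M) = dim_col M" "dim_col (mat_adjoint M) = dim_row M"
  by (simp_all add: mat_adjoint_def)

lemma mat_adjoint_carrier [simp]:
  "M \<in> carrier_mat n k \<Longrightarrow> mat_adjoint M \<in> carrier_mat k n"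
  by (metis carrier_matD carrier_matI mat_adjoint_dim)

lemma mat_adjoint_mult:
  fixes M N :: "complex mat"
  assumes "M \<in> carrier_mat n k" "N \<in> carrier_mat k l"
  shows "mat_adjoint (M * N) = mat_adjoint N * mat_adjoint M"
  using assms
  by (intro eq_matI) (auto simp: mat_adjoint_index scalar_prod_def intro!: sum.cong)

lemma mat_adjoint_adjoint [simp]: "mat_adjoint (mat_adjoint M) = (M :: complex mat)"
  by (rule eq_matI) (auto simp: mat_adjoint_index)

lemma mat_adjoint_smult: "mat_adjoint (c \<cdot>\<^sub>m M) = cnj c \<cdot>\<^sub>m mat_adjoint (M :: complex mat)"
  by (rule eq_matI) (auto simp: mat_adjoint_index)

section \<open>Reindexing by quotient and remainder, and Kronecker products\<close>

lemma sum_div_mod: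
  fixes f :: "nat \<Rightarrow> nat \<Rightarrow> 'a :: comm_monoid_add"
  shows "(\<Sum>k<n * r. f (k div r) (k mod r)) = (\<Sum>i<n. \<Sum>j<r. f i j)"
proof -
  \<comment> \<open>Block \<open>i\<close> consists of the indices \<open>i * r + j\<close> with
    \<open>j < r\<close>.\<close>
  have "(\<Sum>j<r. f i j) = (\<Sum>k=i * r..<i * r + r. f (k div r) (k mod r))" for i
  proof -
    have "(\<Sum>k=i * r..<i * r + r. f (k div r) (k mod r))
        = (\<Sum>j=0..<r. f ((j + i * r) div r) ((j + i * r) mod r))"
      using sum.shift_bounds_nat_ivl[of "\<lambda>k. f (k div r) (k mod r)" 0 "i * r" r]
      by (simp add: add.commute)
    also have "\<dots> = (\<Sum>j<r. f i j)"
      by (intro sum.cong) auto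
    finally show ?thesis ..
  qed
  then show ?thesis by (simp add: sum.nat_group)
qed

lemma kronecker_dim [simp]:
  "dim_row (kronecker M N) = dim_row M * dim_row N"
  "dim_col (kronecker M N) = dim_col M * dim_col N"
  by (simp_all add: kronecker_def)

lemma kronecker_carrier [simp]:
  "M \<in> carrier_mat a b \<Longrightarrow> N \<in> carrier_mat c d \<Longrightarrow> kronecker M N \<in> carrier_mat (a * c) (b * d)"
  by (auto simp: kronecker_def)

lemma div_mod_less_mult:
  "k < a * c \<Longrightarrow> k div c < a" "k < a * c \<Longrightarrow> k mod c < (c :: nat)"
  by (auto simp: less_mult_imp_div_less intro!: mod_less_divisor gr0I)

text \<open>The mixed-product rule: the summation index splits into quotient and remainder, and the
  resulting double sum factors.\<close>

lemma kronecker_mult: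
  assumes "M \<in> carrier_mat a b" "N \<in> carrier_mat c d"
    and "M' \<in> carrier_mat b e" "N' \<in> carrier_mat d f"
  shows "kronecker M N * kronecker M' N' = kronecker (M * M') (N * N')"
proof (rule eq_matI)
  fix k l
  assume "k < dim_row (kronecker (M * M') (N * N'))" "l < dim_col (kronecker (M * M') (N * N'))"
  then have kl: "k < a * c" "l < e * f" using assms by auto
  note [simp] = div_mod_less_mult[OF kl(1)] div_mod_less_mult[OF kl(2)]
  have "(kronecker M N * kronecker M' N') $$ (k, l) =
     (\<Sum>x<b * d. M $$ (k div c, x div d) * N $$ (k mod c, x mod d) *
        (M' $$ (x div d, l div f) * N' $$ (x mod d, l mod f)))"
    using assms kl by (simp add: scalar_prod_def kronecker_def lessThan_atLeast0)
  also have "\<dots> = (\<Sum>i<b. \<Sum>j<d. M $$ (k div c, i) * N $$ (k mod c, j) *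
        (M' $$ (i, l div f) * N' $$ (j, l mod f)))"
    by (rule sum_div_mod)
  also have "\<dots> = (\<Sum>i<b. M $$ (k div c, i) * M' $$ (i, l div f)) *
      (\<Sum>j<d. N $$ (k mod c, j) * N' $$ (j, l mod f))"
    by (simp add: sum_product mult_ac)
  also have "\<dots> = kronecker (M * M') (N * N') $$ (k, l)"
    using assms kl by (simp add: scalar_prod_def kronecker_def lessThan_atLeast0)
  finally show "(kronecker M N * kronecker M' N') $$ (k, l) = kronecker (M * M') (N * N') $$ (k, l)" .
qed (use assms in auto)

lemma kronecker_adjoint:
  "mat_adjoint (kronecker M N) = kronecker (mat_adjoint M) (mat_adjoint N)"
  by (rule eq_matI) (auto simp: kronecker_def mat_adjoint_index div_mod_less_mult)

lemma kronecker_smult: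
  "kronecker (c \<cdot>\<^sub>m M) N = c \<cdot>\<^sub>m kronecker M N"
  "kronecker M (c \<cdot>\<^sub>m N) = c \<cdot>\<^sub>m kronecker M N"
  by (rule eq_matI; auto simp: kronecker_def div_mod_less_mult)+

text \<open>Evaluates the inverse inside \<open>AB_rep\<close>. For square matrices a right inverse
  is two-sided, so \<open>M\<close> is a unit of the matrix ring, which excludes
  \<open>None\<close>; inverses are unique.\<close>

lemma mat_inverse_eqI:
  fixes M N :: "'a :: field mat"
  assumes M: "M \<in> carrier_mat n n" and N: "N \<in> carrier_mat n n" and MN: "M * N = 1\<^sub>m n"
  shows "mat_inverse M = Some N"
proof (cases "mat_inverse M")
  case None
  have "N * M = 1\<^sub>m n" using mat_mult_left_right_inverse[OF M N MN] .
  then have "M \<in> Units (ring_mat TYPE('a) n ())"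
    unfolding Units_def ring_mat_simps using M N MN by blast
  then show ?thesis using mat_inverse(1)[OF M None, of "()"] by contradiction
next
  case (Some N')
  then have "M * N' = 1\<^sub>m n" "N' * M = 1\<^sub>m n" "N' \<in> carrier_mat n n"
    using mat_inverse(2)[OF M] by auto
  have "N' = N' * (M * N)" using \<open>N' \<in> carrier_mat n n\<close> by (simp add: MN)
  also have "\<dots> = N' * M * N"
    using \<open>N' \<in> carrier_mat n n\<close> by (rule assoc_mult_mat[OF _ M N, symmetric])
  finally have "N' = N" using N \<open>N' * M = 1\<^sub>m n\<close> by simp
  then show ?thesis using Some by simp
qed

section \<open>Intertwiners\<close>

text \<open>The entries are homogeneous of degree \<open>twice s\<close> in those of
  \<open>g\<close>. This homogeneity is the source of the sign in the theorem.\<close>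

lemma spin_rep_smult:
  assumes "g \<in> carrier_mat 2 2"
  shows "spin_rep s (c \<cdot>\<^sub>m g) = c ^ twice s \<cdot>\<^sub>m spin_rep s g"
proof (rule eq_matI)
  fix k i
  assume "k < dim_row (c ^ twice s \<cdot>\<^sub>m spin_rep s g)" "i < dim_col (c ^ twice s \<cdot>\<^sub>m spin_rep s g)"
  then have ki: "k \<le> twice s" "i \<le> twice s" by (auto simp: spin_rep_def Let_def)
  have pow: "smult c u ^ l = smult (c ^ l) (u ^ l)" for u :: "complex poly" and l
    by (rule smult_power)
  have "c ^ i * c ^ (twice s - i) = c ^ twice s" using ki by (simp flip: power_add)
  moreover have "[:c * x, c * y:] = smult c [:x, y:]" for x y by simp
  ultimately show "spin_rep s (c \<cdot>\<^sub>m g) $$ (k, i) = (c ^ twice s \<cdot>\<^sub>m spin_rep s g) $$ (k, i)"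
    using ki assms by (simp add: spin_rep_def Let_def pow del: smult_pCons)
qed (auto simp: spin_rep_def Let_def)

section \<open>The diagonal torus and its weights\<close>

lemma mat_diag_dims [simp]: "dim_row (mat_diag n f) = n" "dim_col (mat_diag n f) = n"
  by (simp_all add: mat_diag_def)

lemma coeff_torus:
  fixes z w :: complex
  shows "coeff ([:z, 0:] ^ m * [:0, w:] ^ i) k = (if k = i then z ^ m * w ^ i else 0)"
proof -
  have "[:z, 0:] ^ m = [:z ^ m:]"
    by (metis pCons_0_0 poly_const_pow)
  moreover have "[:0, w:] ^ i = monom (w ^ i) i"
    by (metis monom_Suc monom_0 monom_power One_nat_def mult_1)
  ultimately have "[:z, 0:] ^ m * [:0, w:] ^ i = smult (z ^ m) (monom (w ^ i) i)"
    by simp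
  then show ?thesis by (simp only: coeff_smult coeff_monom) simp
qed

text \<open>The exponent is twice the magnetic quantum number \<open>s - i\<close> when
  \<open>n = 2 s\<close>.\<close>

lemma torus_weight:
  assumes "z \<noteq> (0::complex)" "i \<le> n"
  shows "z ^ (n - i) * (1 / z) ^ i = z powi (int n - 2 * int i)"
proof -
  have e: "int n - 2 * int i = int (n - i) - int i" using assms(2) by linarith
  have "z powi (int n - 2 * int i) = z powi int (n - i) / z powi int i"
    unfolding e by (rule power_int_diff) (simp add: assms(1))
  also have "\<dots> = z ^ (n - i) * (1 / z) ^ i"
    by (simp only: power_int_of_nat power_divide power_one times_divide_eq_right mult_1_right)
  finally show ?thesis by (rule sym)
qed

text \<open>The substitution sends \<open>x\<close> to \<open>z x\<close> and \<open>y\<close> to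
  \<open>y / z\<close>, so it only rescales each monomial.\<close>

lemma spin_rep_torus:
  assumes "z \<noteq> 0"
  shows "spin_rep s (mat2 z 0 0 (1 / z)) =
    mat_diag (twice s + 1) (\<lambda>i. z powi (int (twice s) - 2 * int i))"
proof (rule eq_matI)
  let ?n = "twice s"
  fix k i
  assume "k < dim_row (mat_diag (?n + 1) (\<lambda>i. z powi (int ?n - 2 * int i)))"
    "i < dim_col (mat_diag (?n + 1) (\<lambda>i. z powi (int ?n - 2 * int i)))"
  then have ki: "k < ?n + 1" "i < ?n + 1" unfolding mat_diag_dims .
  have "spin_rep s (mat2 z 0 0 (1 / z)) $$ (k, i) =
      of_real (sqrt (fact (?n - k) * fact k) / sqrt (fact (?n - i) * fact i)) *
      coeff ([:z, 0:] ^ (?n - i) * [:0, 1 / z:] ^ i) k"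
    using ki unfolding spin_rep_def Let_def One_nat_def by (simp only: index_mat case_prod_conv mat2_index)
  also have "\<dots> = (if k = i then z powi (int ?n - 2 * int i) else 0)"
    unfolding coeff_torus using ki torus_weight[OF assms, of i ?n] by (cases "k = i") simp_all
  also have "\<dots> = mat_diag (?n + 1) (\<lambda>i. z powi (int ?n - 2 * int i)) $$ (k, i)"
    using ki unfolding mat_diag_def by (simp only: index_mat case_prod_conv)
  finally show "spin_rep s (mat2 z 0 0 (1 / z)) $$ (k, i)
      = mat_diag (?n + 1) (\<lambda>i. z powi (int ?n - 2 * int i)) $$ (k, i)" .
qed (simp_all add: spin_rep_def Let_def)

lemma kronecker_mat_diag:
  "kronecker (mat_diag a f) (mat_diag b g) = mat_diag (a * b) (\<lambda>k. f (k div b) * g (k mod b))"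
proof (rule eq_matI)
  fix k l
  assume "k < dim_row (mat_diag (a * b) (\<lambda>k. f (k div b) * g (k mod b)))"
    "l < dim_col (mat_diag (a * b) (\<lambda>k. f (k div b) * g (k mod b)))"
  then have kl: "k < a * b" "l < a * b" by auto
  note [simp] = div_mod_less_mult[OF kl(1)] div_mod_less_mult[OF kl(2)]
  have "k div b = l div b \<and> k mod b = l mod b \<longleftrightarrow> k = l"
    by (metis div_mult_mod_eq)
  then show "kronecker (mat_diag a f) (mat_diag b g) $$ (k, l) =
      mat_diag (a * b) (\<lambda>k. f (k div b) * g (k mod b)) $$ (k, l)"
    using kl by (auto simp: kronecker_def mat_diag_def)
qed (auto simp: kronecker_def)

text \<open>The two arguments are kept independent: \<open>h\<close> the inverse adjoint of
  \<open>g\<close> gives \<open>AB_rep\<close>, while \<open>g = h\<close> gives the holomorphic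
  extension of the SU(2) action, to which intertwining relations extend.\<close>

definition tensor_rep :: "real \<Rightarrow> real \<Rightarrow> complex mat \<Rightarrow> complex mat \<Rightarrow> complex mat" where
  "tensor_rep A B g h = kronecker (spin_rep A g) (spin_rep B h)"

lemma tensor_rep_carrier [simp]: "tensor_rep A B g h \<in> carrier_mat (AB_dim A B) (AB_dim A B)"
  unfolding tensor_rep_def AB_dim_def by (intro kronecker_carrier spin_rep_carrier)

lemma tensor_rep_mult:
  assumes "g \<in> carrier_mat 2 2" "g' \<in> carrier_mat 2 2" "h \<in> carrier_mat 2 2" "h' \<in> carrier_mat 2 2"
  shows "tensor_rep A B g h * tensor_rep A B g' h' = tensor_rep A B (g * g') (h * h')"
  unfolding tensor_rep_def spin_rep_mult[OF assms(1,2)] spin_rep_mult[OF assms(3,4)]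
  by (rule kronecker_mult[OF spin_rep_carrier spin_rep_carrier spin_rep_carrier spin_rep_carrier])

lemma tensor_rep_adjoint:
  assumes "g \<in> carrier_mat 2 2" "h \<in> carrier_mat 2 2"
  shows "mat_adjoint (tensor_rep A B g h) = tensor_rep A B (mat_adjoint g) (mat_adjoint h)"
  using assms by (simp add: tensor_rep_def kronecker_adjoint spin_rep_adjoint)

text \<open>Weights add in a tensor product; quotient and remainder of \<open>k\<close> index the
  two factors.\<close>

lemma tensor_rep_torus:
  assumes "z \<noteq> 0"
  shows "tensor_rep A B (mat2 z 0 0 (1 / z)) (mat2 z 0 0 (1 / z)) = mat_diag (AB_dim A B)
    (\<lambda>k. z powi (int (twice A) - 2 * int (k div (twice B + 1)) +
      (int (twice B) - 2 * int (k mod (twice B + 1)))))"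
  by (simp add: tensor_rep_def spin_rep_torus[OF assms] kronecker_mat_diag AB_dim_def
      power_int_add[OF disjI1[OF assms]])

section \<open>Extending intertwining relations from SU(2) to Hermitian elements\<close>

lemma SU2_adjoint: "W \<in> SU2 \<Longrightarrow> mat_adjoint W \<in> SU2"
proof -
  assume W: "W \<in> SU2"
  then have c: "W \<in> carrier_mat 2 2" "mat_adjoint W * W = 1\<^sub>m 2" "Determinant.det W = 1"
    by (auto simp: SU2_def SL2C_def)
  have "W * mat_adjoint W = 1\<^sub>m 2"
    using mat_mult_left_right_inverse[OF mat_adjoint_carrier[OF c(1)] c(1,2)] .
  moreover have "Determinant.det (mat_adjoint W) = 1"
  proof -
    obtain a b c' d where W': "W = mat2 a b c' d" using c(1) by (rule mat2_cases)
    have "Determinant.det (mat_adjoint W) = cnj (Determinant.det W)" by (simp add: W' mult_ac)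
    then show ?thesis using c by simp
  qed
  ultimately show ?thesis using c by (simp add: SU2_def SL2C_def)
qed

lemma torus_SU2:
  assumes "cmod z = 1"
  shows "mat2 z 0 0 (1 / z) \<in> SU2"
proof -
  have "z \<noteq> 0" using assms by auto
  moreover have "cnj z * z = 1"
    using assms by (metis complex_norm_square mult.commute of_real_1 power_one)
  ultimately show ?thesis
    by (simp add: SU2_def SL2C_def one_mat2 flip: complex_cnj_mult)
qed

lemma power_int_eq_on_circle:
  assumes "\<And>z. cmod z = 1 \<Longrightarrow> z powi a = z powi b"
  shows "a = b"
proof (rule ccontr)
  assume "a \<noteq> b"
  \<comment> \<open>Chosen so that \<open>z powi (a - b)\<close> is \<open>cis pi\<close>, that is
    \<open>-1\<close>, whereas equal powers would make it 1.\<close>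
  define z where "z = cis (pi / of_int (a - b))"
  have "z powi (a - b) = cis (of_int (a - b) * (pi / of_int (a - b)))"
    unfolding z_def by (rule cis_power_int)
  also have "\<dots> = -1" using \<open>a \<noteq> b\<close> by simp
  finally have "z powi (a - b) = -1" .
  moreover have "z powi (a - b) = z powi a / z powi b"
    by (rule power_int_diff) (simp add: z_def)
  moreover have "z powi a = z powi b" by (rule assms) (simp add: z_def)
  ultimately show False by (simp add: z_def)
qed

text \<open>The relation on the unit circle forces every nonzero entry of \<open>M\<close> to join
  basis vectors of equal weight; then it holds for every nonzero \<open>z\<close>.\<close>

lemma intertwiner_torus:
  assumes M: "M \<in> carrier_mat (AB_dim A B) (AB_dim C D)"
    and int: "\<And>W. W \<in> SU2 \<Longrightarrow> M * tensor_rep C D W W = tensor_rep A B W W * M"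
    and z: "z \<noteq> 0"
  defines "g \<equiv> mat2 z 0 0 (1 / z)"
  shows "M * tensor_rep C D g g = tensor_rep A B g g * M"
proof -
  define w where "w A B k = int (twice A) - 2 * int (k div (twice B + 1)) +
      (int (twice B) - 2 * int (k mod (twice B + 1)))" for A B k
  have L: "tensor_rep A B (mat2 z 0 0 (1 / z)) (mat2 z 0 0 (1 / z)) * M =
      Matrix.mat (AB_dim A B) (AB_dim C D) (\<lambda>(k, l). z powi w A B k * M $$ (k, l))" if "z \<noteq> 0" for z
    unfolding tensor_rep_torus[OF that] w_def by (rule mat_diag_mult_left[OF M])
  have R: "M * tensor_rep C D (mat2 z 0 0 (1 / z)) (mat2 z 0 0 (1 / z)) =
      Matrix.mat (AB_dim A B) (AB_dim C D) (\<lambda>(k, l). M $$ (k, l) * z powi w C D l)" if "z \<noteq> 0" for z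
    unfolding tensor_rep_torus[OF that] w_def by (rule mat_diag_mult_right[OF M])
  \<comment> \<open>Entry \<open>(k, l)\<close> of the relation is \<open>M $$ (k, l)\<close> times
    two powers of \<open>z\<close>; a nonzero entry cancels and leaves equal powers on the whole
    circle.\<close>
  have weight: "w C D l = w A B k"
    if kl: "k < AB_dim A B" "l < AB_dim C D" "M $$ (k, l) \<noteq> 0" for k l
  proof (rule power_int_eq_on_circle)
    fix z :: complex assume "cmod z = 1"
    then have "z \<noteq> 0" and "mat2 z 0 0 (1 / z) \<in> SU2" by (auto intro: torus_SU2)
    from int[OF this(2)] show "z powi w C D l = z powi w A B k"
      unfolding L[OF \<open>z \<noteq> 0\<close>] R[OF \<open>z \<noteq> 0\<close>] using kl
      by (auto dest!: arg_cong[of _ _ "\<lambda>N. N $$ (k, l)"])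
  qed
  show ?thesis unfolding g_def L[OF z] R[OF z]
  proof (rule eq_matI, goal_cases)
    case (1 k l)
    then show ?case using weight[of k l] by (cases "M $$ (k, l) = 0") auto
  qed auto
qed

text \<open>The spectral theorem done by hand: a normalized eigenvector is completed to a matrix in
  SU(2), and determinant 1 makes the two diagonal entries reciprocal.\<close>

lemma SL2C_hermitian_diagonalization:
  assumes "L \<in> SL2C" "mat_adjoint L = L"
  obtains V z where "V \<in> SU2" "z \<noteq> 0" "L = V * mat2 z 0 0 (1 / z) * mat_adjoint V"
proof -
  have L: "L \<in> carrier_mat 2 2" "Determinant.det L = 1" using assms by (auto simp: SL2C_def)
  obtain a d :: real and b where Le: "L = mat2 a b (cnj b) d"
    using L(1) assms(2) by (rule hermitian_mat2)
  have det: "a * d - b * cnj b = 1" using L by (simp add: Le)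
  show thesis
  proof (cases "b = 0")
    case True
    then have "complex_of_real a \<noteq> 0" "complex_of_real d = 1 / a" using det
      by (auto simp: eq_divide_eq mult.commute)
    then show thesis
      by (intro that[of "1\<^sub>m 2" a]) (auto simp: one_mat2 Le True SU2_def SL2C_def)
  next
    case False
    define t where "t = complex_of_real (a + d)"
    \<comment> \<open>A root of the characteristic polynomial, whose constant term is the
      determinant 1.\<close>
    define \<mu> where "\<mu> = (t + csqrt (t\<^sup>2 - 4)) / 2"
    have char: "\<mu>\<^sup>2 - t * \<mu> + 1 = 0"
    proof -
      have "2 * \<mu> - t = csqrt (t\<^sup>2 - 4)" by (simp add: \<mu>_def field_simps)
      then have "(2 * \<mu> - t)\<^sup>2 = t\<^sup>2 - 4" by simp
      moreover have "4 * (\<mu>\<^sup>2 - t * \<mu> + 1) = (2 * \<mu> - t)\<^sup>2 - (t\<^sup>2 - 4)"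
        by (simp add: algebra_simps power2_eq_square)
      ultimately have "4 * (\<mu>\<^sup>2 - t * \<mu> + 1) = 0" by (simp only: diff_self)
      then show ?thesis by (metis mult_eq_0_iff zero_neq_numeral)
    qed
    \<comment> \<open>The vector \<open>(b, \<mu> - a)\<close> solves the first row of the
      eigenvalue equation and is nonzero because \<open>b\<close> is; \<open>r\<close> is its
      norm.\<close>
    define r where "r = sqrt ((cmod b)\<^sup>2 + (cmod (\<mu> - a))\<^sup>2)"
    have r: "r > 0" using False by (simp add: r_def add_pos_nonneg)
    define x where "x = b / r"
    define y where "y = (\<mu> - a) / r"
    have "(cmod x)\<^sup>2 + (cmod y)\<^sup>2 = ((cmod b)\<^sup>2 + (cmod (\<mu> - a))\<^sup>2) / r\<^sup>2"
      using r by (simp add: x_def y_def norm_divide power_divide add_divide_distrib)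
    also have "(cmod b)\<^sup>2 + (cmod (\<mu> - a))\<^sup>2 = r\<^sup>2" by (simp add: r_def)
    also have "r\<^sup>2 / r\<^sup>2 = 1" using r by simp
    finally have "complex_of_real ((cmod x)\<^sup>2 + (cmod y)\<^sup>2) = 1" by (simp only: of_real_1)
    then have unit: "x * cnj x + y * cnj y = 1" by (simp add: of_real_cmod_square)
    have eig: "a * x + b * y = \<mu> * x" "cnj b * x + d * y = \<mu> * y"
    proof -
      show "a * x + b * y = \<mu> * x" using r by (simp add: x_def y_def field_simps)
      have "cnj b * b + d * (\<mu> - a) - \<mu> * (\<mu> - a) = - (\<mu>\<^sup>2 - t * \<mu> + (a * d - b * cnj b))"
        by (simp add: t_def algebra_simps power2_eq_square)
      also have "\<dots> = 0" using char det by simp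
      finally have "cnj b * b + d * (\<mu> - a) = \<mu> * (\<mu> - a)" by simp
      then have "(cnj b * b + d * (\<mu> - a)) / r = \<mu> * (\<mu> - a) / r" by simp
      then show "cnj b * x + d * y = \<mu> * y" by (simp add: x_def y_def add_divide_distrib)
    qed
    \<comment> \<open>The second column is the unit vector orthogonal to \<open>(x, y)\<close> that
      gives determinant 1.\<close>
    define V where "V = mat2 x (- cnj y) y (cnj x)"
    have V: "V \<in> SU2" using unit by (simp add: V_def SU2_def SL2C_def one_mat2 algebra_simps)
    have Vc: "V \<in> carrier_mat 2 2" by (simp add: V_def)
    have VV: "V * mat_adjoint V = 1\<^sub>m 2" using unit by (simp add: V_def one_mat2 algebra_simps)
    define T where "T = mat_adjoint V * L * V"
    have Tc: "T \<in> carrier_mat 2 2" using Vc L by (simp add: T_def V_def Le)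
    have "mat_adjoint T = T" unfolding T_def
      using L(1) Vc assms(2)
      by (simp add: mat_adjoint_mult[of _ 2 2 _ 2] assoc_mult_mat[of _ 2 2 _ 2 _ 2])
    then obtain e h :: real and f where T: "T = mat2 e f (cnj f) h"
      using Tc by (elim hermitian_mat2)
    \<comment> \<open>The lower left entry of \<open>T\<close> pairs \<open>(- y, x)\<close> with
      \<open>L\<close> applied to \<open>(x, y)\<close>, which is \<open>\<mu>\<close> times
      \<open>(x, y)\<close>; the pairing vanishes.\<close>
    have "cnj f = - y * (a * x + b * y) + x * (cnj b * x + d * y)"
      using T by (simp add: T_def V_def Le algebra_simps)
    then have f: "f = 0" unfolding eig by (simp add: algebra_simps)
    have "Determinant.det T = 1"
      using det_mult[of V 2 "mat_adjoint V"] VV V Vc L unfolding T_def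
      by (simp add: det_mult[OF mult_carrier_mat[OF mat_adjoint_carrier[OF Vc] L(1)] Vc]
          det_mult[OF mat_adjoint_carrier[OF Vc] L(1)] SU2_def SL2C_def)
    then have eh: "complex_of_real e * h = 1" by (simp add: T f)
    then have "complex_of_real e \<noteq> 0" "complex_of_real h = 1 / e"
      by (auto simp: eq_divide_eq mult.commute)
    moreover have "V * T * mat_adjoint V = L"
    proof -
      have "V * T = V * mat_adjoint V * L * V"
        unfolding T_def using Vc L(1) mat_adjoint_carrier[OF Vc]
        by (simp add: assoc_mult_mat[of _ 2 2 _ 2 _ 2] mult_carrier_mat[of _ 2 2 _ 2])
      then have "V * T * mat_adjoint V = L * (V * mat_adjoint V)"
        using Vc L(1) mat_adjoint_carrier[OF Vc] by (simp add: VV assoc_mult_mat[of _ 2 2 _ 2 _ 2])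
      then show ?thesis using L(1) by (simp add: VV)
    qed
    ultimately show thesis using V by (intro that[of V e]) (auto simp: T f)
  qed
qed

lemma intertwiner_mult:
  assumes M: "M \<in> carrier_mat (AB_dim A B) (AB_dim C D)"
    and g: "g \<in> carrier_mat 2 2" "M * tensor_rep C D g g = tensor_rep A B g g * M"
    and h: "h \<in> carrier_mat 2 2" "M * tensor_rep C D h h = tensor_rep A B h h * M"
  shows "M * tensor_rep C D (g * h) (g * h) = tensor_rep A B (g * h) (g * h) * M"
proof -
  have "M * tensor_rep C D (g * h) (g * h) = M * (tensor_rep C D g g * tensor_rep C D h h)"
    using g h by (simp add: tensor_rep_mult)
  also have "\<dots> = M * tensor_rep C D g g * tensor_rep C D h h"
    by (rule assoc_mult_mat[OF M tensor_rep_carrier tensor_rep_carrier, symmetric])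
  also have "\<dots> = tensor_rep A B g g * (M * tensor_rep C D h h)"
    unfolding g(2) by (rule assoc_mult_mat[OF tensor_rep_carrier M tensor_rep_carrier])
  also have "\<dots> = tensor_rep A B g g * tensor_rep A B h h * M"
    unfolding h(2) by (rule assoc_mult_mat[OF tensor_rep_carrier tensor_rep_carrier M, symmetric])
  finally show ?thesis using g h by (simp add: tensor_rep_mult)
qed

text \<open>In the diagonalization of \<open>L\<close> the outer factors lie in SU(2) and the middle
  one in the complex torus; the relation holds for each and passes to products.\<close>

lemma intertwiner_hermitian:
  assumes M: "M \<in> carrier_mat (AB_dim A B) (AB_dim C D)"
    and int: "\<And>W. W \<in> SU2 \<Longrightarrow> M * tensor_rep C D W W = tensor_rep A B W W * M"
    and L: "L \<in> SL2C" "mat_adjoint L = L"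
  shows "M * tensor_rep C D L L = tensor_rep A B L L * M"
proof -
  obtain V z where V: "V \<in> SU2" "z \<noteq> 0" "L = V * mat2 z 0 0 (1 / z) * mat_adjoint V"
    using L by (rule SL2C_hermitian_diagonalization)
  then have "V \<in> carrier_mat 2 2" by (simp add: SU2_def SL2C_def)
  then show ?thesis
    unfolding V(3) using V(1,2)
    by (intro intertwiner_mult[OF M] int SU2_adjoint intertwiner_torus[OF M int]) auto
qed

section \<open>Polynomial matrix functions\<close>

definition monomial :: "nat \<times> nat \<times> nat \<times> nat \<Rightarrow> four_vec \<Rightarrow> complex" where
  "monomial = (\<lambda>(a, b, d, e) (p, p0). of_real ((p $ 1) ^ a * (p $ 2) ^ b * (p $ 3) ^ d * p0 ^ e))"

text \<open>Finite sums of scaled monomials as functions, so that polynomiality is proved by closure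
  rules and coefficients are extracted only once, in \<open>poly_fun_expansion\<close>.\<close>

inductive poly_fun :: "(four_vec \<Rightarrow> complex) \<Rightarrow> bool" where
  poly_fun_monomial: "poly_fun (\<lambda>q. monomial \<alpha> q * c)"
| poly_fun_add: "poly_fun f \<Longrightarrow> poly_fun g \<Longrightarrow> poly_fun (\<lambda>q. f q + g q)"

lemma poly_fun_const: "poly_fun (\<lambda>q. c)"
  using poly_fun_monomial[of "(0, 0, 0, 0)" c] by (simp add: monomial_def case_prod_beta')

lemma poly_fun_sum: "(\<And>x. x \<in> I \<Longrightarrow> poly_fun (f x)) \<Longrightarrow> poly_fun (\<lambda>q. \<Sum>x\<in>I. f x q)"
  by (induction I rule: infinite_finite_induct) (simp_all add: poly_fun_const poly_fun_add)

lemma monomial_mult: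
  "\<exists>\<gamma>. \<forall>q. monomial \<alpha> q * monomial \<beta> q = monomial \<gamma> q"
proof -
  obtain a b d e a' b' d' e' where [simp]: "\<alpha> = (a, b, d, e)" "\<beta> = (a', b', d', e')"
    by (cases \<alpha>, cases \<beta>) blast
  have "monomial \<alpha> q * monomial \<beta> q = monomial (a + a', b + b', d + d', e + e') q" for q
    by (cases q) (simp add: monomial_def power_add mult_ac)
  then show ?thesis by blast
qed

lemma poly_fun_mult:
  assumes f: "poly_fun f" and g: "poly_fun g"
  shows "poly_fun (\<lambda>q. f q * g q)"
  using f
proof induction
  case (poly_fun_monomial \<alpha> c)
  show ?case using g
  proof induction
    case (poly_fun_monomial \<beta> d)
    obtain \<gamma> where \<gamma>: "\<forall>q. monomial \<alpha> q * monomial \<beta> q = monomial \<gamma> q"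
      using monomial_mult by blast
    have "(\<lambda>q. monomial \<alpha> q * c * (monomial \<beta> q * d)) = (\<lambda>q. monomial \<gamma> q * (c * d))"
      using \<gamma> by (intro ext) (metis mult.assoc mult.left_commute)
    then show ?case by (simp only: poly_fun.poly_fun_monomial)
  qed (simp add: distrib_left poly_fun_add)
qed (simp add: distrib_right poly_fun_add)

lemma poly_fun_power: "poly_fun f \<Longrightarrow> poly_fun (\<lambda>q. f q ^ n)"
  by (induction n) (simp_all add: poly_fun_const poly_fun_mult)

text \<open>Coefficients are required to vanish off \<open>S\<close> so that the support can be
  enlarged to a union without changing the sum.\<close>

lemma poly_fun_expansion:
  assumes "poly_fun f"
  shows "\<exists>S c. finite S \<and> (\<forall>\<alpha>. \<alpha> \<notin> S \<longrightarrow> c \<alpha> = 0) \<and> (\<forall>q. f q = (\<Sum>\<alpha>\<in>S. monomial \<alpha> q * c \<alpha>))"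
  using assms
proof induction
  case (poly_fun_monomial \<alpha> c)
  show ?case by (intro exI[of _ "{\<alpha>}"] exI[of _ "\<lambda>\<beta>. if \<beta> = \<alpha> then c else 0"]) auto
next
  case (poly_fun_add f g)
  from poly_fun_add.IH obtain S c T d where S: "finite S" "\<forall>\<alpha>. \<alpha> \<notin> S \<longrightarrow> c \<alpha> = 0" "\<And>q. f q = (\<Sum>\<alpha>\<in>S. monomial \<alpha> q * c \<alpha>)"
    and T: "finite T" "\<forall>\<alpha>. \<alpha> \<notin> T \<longrightarrow> d \<alpha> = 0" "\<And>q. g q = (\<Sum>\<alpha>\<in>T. monomial \<alpha> q * d \<alpha>)"
    by blast
  have "f q = (\<Sum>\<alpha>\<in>S \<union> T. monomial \<alpha> q * c \<alpha>)" for q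
    unfolding S(3) using S T by (intro sum.mono_neutral_left) auto
  moreover have "g q = (\<Sum>\<alpha>\<in>S \<union> T. monomial \<alpha> q * d \<alpha>)" for q
    unfolding T(3) using S T by (intro sum.mono_neutral_left) auto
  ultimately have "f q + g q = (\<Sum>\<alpha>\<in>S \<union> T. monomial \<alpha> q * (c \<alpha> + d \<alpha>))" for q
    by (simp add: distrib_left sum.distrib)
  then show ?case
    using S T by (intro exI[of _ "S \<union> T"] exI[of _ "\<lambda>\<alpha>. c \<alpha> + d \<alpha>"]) auto
qed

section \<open>Matrix-valued polynomial functions\<close>

definition poly_mat :: "nat \<Rightarrow> nat \<Rightarrow> (four_vec \<Rightarrow> complex mat) \<Rightarrow> bool" where
  "poly_mat nr nc F \<longleftrightarrow> (\<forall>q. F q \<in> carrier_mat nr nc) \<and>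
     (\<forall>i<nr. \<forall>l<nc. poly_fun (\<lambda>q. F q $$ (i, l)))"

lemma poly_mat_carrier: "poly_mat nr nc F \<Longrightarrow> F q \<in> carrier_mat nr nc"
  unfolding poly_mat_def by blast

lemma poly_mat_entry:
  "poly_mat nr nc F \<Longrightarrow> i < nr \<Longrightarrow> l < nc \<Longrightarrow> poly_fun (\<lambda>q. F q $$ (i, l))"
  unfolding poly_mat_def by blast

lemma poly_matI:
  assumes "\<And>q. F q \<in> carrier_mat nr nc"
    and "\<And>i l. i < nr \<Longrightarrow> l < nc \<Longrightarrow> poly_fun (\<lambda>q. F q $$ (i, l))"
  shows "poly_mat nr nc F"
  using assms unfolding poly_mat_def by blast

lemma poly_mat_const: "M \<in> carrier_mat nr nc \<Longrightarrow> poly_mat nr nc (\<lambda>q. M)"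
  by (simp add: poly_mat_def poly_fun_const)

lemma poly_mat_smult:
  assumes F: "poly_mat nr nc F"
  shows "poly_mat nr nc (\<lambda>q. c \<cdot>\<^sub>m F q)"
proof (rule poly_matI)
  fix i l assume il: "i < nr" "l < nc"
  then have "(\<lambda>q. (c \<cdot>\<^sub>m F q) $$ (i, l)) = (\<lambda>q. c * F q $$ (i, l))"
    using carrier_matD[OF poly_mat_carrier[OF F]] by (intro ext) simp
  then show "poly_fun (\<lambda>q. (c \<cdot>\<^sub>m F q) $$ (i, l))"
    using poly_fun_mult[OF poly_fun_const poly_mat_entry[OF F il]] by simp
qed (rule smult_carrier_mat[OF poly_mat_carrier[OF F]])

lemma poly_mat_mult:
  assumes F: "poly_mat nr n F" and G: "poly_mat n nc G"
  shows "poly_mat nr nc (\<lambda>q. F q * G q)"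
proof -
  have c: "F q \<in> carrier_mat nr n" "G q \<in> carrier_mat n nc" for q
    using F G by (auto intro: poly_mat_carrier)
  have "(\<lambda>q. (F q * G q) $$ (i, l)) = (\<lambda>q. \<Sum>x<n. F q $$ (i, x) * G q $$ (x, l))"
    if "i < nr" "l < nc" for i l
    using c that carrier_matD[OF c(1)] carrier_matD[OF c(2)]
    by (simp add: scalar_prod_def lessThan_atLeast0)
  moreover have "poly_fun (\<lambda>q. \<Sum>x<n. F q $$ (i, x) * G q $$ (x, l))" if "i < nr" "l < nc" for i l
    using that by (intro poly_fun_sum poly_fun_mult poly_mat_entry[OF F] poly_mat_entry[OF G]) auto
  ultimately show ?thesis
    using c by (intro poly_matI mult_carrier_mat) simp_all
qed

lemma poly_mat_kronecker:
  assumes F: "poly_mat a b F" and G: "poly_mat c d G"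
  shows "poly_mat (a * c) (b * d) (\<lambda>q. kronecker (F q) (G q))"
proof -
  have carr: "F q \<in> carrier_mat a b" "G q \<in> carrier_mat c d" for q
    using F G by (auto intro: poly_mat_carrier)
  have "poly_fun (\<lambda>q. kronecker (F q) (G q) $$ (i, l))" if il: "i < a * c" "l < b * d" for i l
  proof -
    have "(\<lambda>q. kronecker (F q) (G q) $$ (i, l)) =
        (\<lambda>q. F q $$ (i div c, l div d) * G q $$ (i mod c, l mod d))"
      using il carrier_matD[OF carr(1)] carrier_matD[OF carr(2)] by (simp add: kronecker_def)
    then show ?thesis
      using poly_fun_mult[OF poly_mat_entry[OF F div_mod_less_mult(1)[OF il(1)] div_mod_less_mult(1)[OF il(2)]]
        poly_mat_entry[OF G div_mod_less_mult(2)[OF il(1)] div_mod_less_mult(2)[OF il(2)]]]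
      by simp
  qed
  then show ?thesis using carr by (intro poly_matI kronecker_carrier)
qed

lemma poly_mat_spin_rep:
  assumes "poly_mat 2 2 F"
  shows "poly_mat (twice s + 1) (twice s + 1) (\<lambda>q. spin_rep s (F q))"
proof -
  note F = poly_mat_entry[OF assms]
  have "poly_fun (\<lambda>q. spin_rep s (F q) $$ (k, i))" if "k \<le> twice s" "i \<le> twice s" for k i
    \<comment> \<open>The explicit entry formula is a polynomial in the entries of the argument; the
      factorial denominators become constant factors.\<close>
    unfolding spin_rep_entry[OF that] divide_inverse
    by (intro poly_fun_mult poly_fun_sum poly_fun_power poly_fun_const F) auto
  then show ?thesis by (intro poly_matI spin_rep_carrier) auto
qed

lemma matrix_polynomial_poly_mat:
  assumes F: "poly_mat nr nc F"
  shows "matrix_polynomial nr nc F"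
proof -
  let ?I = "{..<nr} \<times> {..<nc}"
  define R where "R il S c \<longleftrightarrow> finite S \<and> (\<forall>\<alpha>. \<alpha> \<notin> S \<longrightarrow> c \<alpha> = 0) \<and>
    (\<forall>q. F q $$ il = (\<Sum>\<alpha>\<in>S. monomial \<alpha> q * c \<alpha>))" for il S c
  have "\<exists>S c. R il S c" if "il \<in> ?I" for il
    unfolding R_def using that by (cases il) (rule poly_fun_expansion, simp add: poly_mat_entry[OF F])
  then obtain S c where R: "\<And>il. il \<in> ?I \<Longrightarrow> R il (S il) (c il)"
    by metis
  note Sc = R[unfolded R_def]
  \<comment> \<open>A common finite set of exponents for all entries; \<open>c il\<close> is zero
    off \<open>S il\<close>, so the extra exponents contribute nothing.\<close>
  define T where "T = (\<Union>il\<in>?I. S il)"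
  define C where "C \<alpha> = Matrix.mat nr nc (\<lambda>il. c il \<alpha>)" for \<alpha>
  have "finite T" unfolding T_def using Sc by blast
  have "F (p, p0) = Matrix.mat nr nc (\<lambda>kl. \<Sum>(a, b, d, e) \<in> T.
      of_real ((p $ 1) ^ a * (p $ 2) ^ b * (p $ 3) ^ d * p0 ^ e) * C (a, b, d, e) $$ kl)" for p p0
  proof (rule eq_matI, goal_cases)
    case (1 k l)
    then have kl: "k < nr" "l < nc" by auto
    then have "F (p, p0) $$ (k, l) = (\<Sum>\<alpha>\<in>S (k, l). monomial \<alpha> (p, p0) * c (k, l) \<alpha>)"
      using Sc by simp
    also have "\<dots> = (\<Sum>\<alpha>\<in>T. monomial \<alpha> (p, p0) * c (k, l) \<alpha>)"
      using \<open>finite T\<close> Sc[of "(k, l)"] kl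
      by (intro sum.mono_neutral_left) (auto simp: T_def)
    also have "\<dots> = (\<Sum>(a, b, d, e) \<in> T.
      of_real ((p $ 1) ^ a * (p $ 2) ^ b * (p $ 3) ^ d * p0 ^ e) * C (a, b, d, e) $$ (k, l))"
      using kl by (intro sum.cong) (auto simp: monomial_def C_def)
    finally show ?case using kl by simp
  qed (use carrier_matD[OF poly_mat_carrier[OF F]] in simp_all)
  then show ?thesis unfolding matrix_polynomial_def
    using \<open>finite T\<close> by (intro exI[of _ T] exI[of _ C]) (auto simp: C_def)
qed

lemma poly_mat_X_mat:
  "poly_mat 2 2 X_mat" "poly_mat 2 2 (\<lambda>(p, p0). X_mat (- p, p0))"
proof -
  have e0: "poly_fun (\<lambda>(p, p0). of_real p0)" and e1: "poly_fun (\<lambda>(p, p0). of_real (p $ 1))"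
    and e2: "poly_fun (\<lambda>(p, p0). of_real (p $ 2))" and e3: "poly_fun (\<lambda>(p, p0). of_real (p $ 3))"
    using poly_fun_monomial[of "(0, 0, 0, 1)" 1] poly_fun_monomial[of "(1, 0, 0, 0)" 1]
      poly_fun_monomial[of "(0, 1, 0, 0)" 1] poly_fun_monomial[of "(0, 0, 1, 0)" 1]
    by (simp_all add: monomial_def case_prod_beta')
  have lin: "poly_fun (\<lambda>(p, p0). \<alpha> * of_real p0 + \<beta> * of_real (p $ 1) + \<gamma> * of_real (p $ 2) + \<delta> * of_real (p $ 3))"
    for \<alpha> \<beta> \<gamma> \<delta>
    using poly_fun_add[OF poly_fun_add[OF poly_fun_add[OF
      poly_fun_mult[OF poly_fun_const[of \<alpha>] e0] poly_fun_mult[OF poly_fun_const[of \<beta>] e1]]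
      poly_fun_mult[OF poly_fun_const[of \<gamma>] e2]] poly_fun_mult[OF poly_fun_const[of \<delta>] e3]]
    by (simp add: case_prod_beta')
  \<comment> \<open>The values 1 and -1 of \<open>\<epsilon>\<close> give the two claims; the four
    instances of \<open>lin\<close> below are the four matrix entries.\<close>
  have "poly_mat 2 2 (\<lambda>(p, p0). X_mat (\<epsilon> *\<^sub>R p, p0))" for \<epsilon> :: real
  proof (rule poly_matI)
    fix q show "(case q of (p, p0) \<Rightarrow> X_mat (\<epsilon> *\<^sub>R p, p0)) \<in> carrier_mat 2 2"
      by (cases q) (simp add: X_mat_eq)
  next
    fix i l :: nat assume "i < 2" "l < 2"
    then show "poly_fun (\<lambda>q. (case q of (p, p0) \<Rightarrow> X_mat (\<epsilon> *\<^sub>R p, p0)) $$ (i, l))"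
      using lin[of 1 0 0 "- \<epsilon>"] lin[of 0 "- \<epsilon>" "\<i> * \<epsilon>" 0] lin[of 0 "- \<epsilon>" "- \<i> * \<epsilon>" 0] lin[of 1 0 0 \<epsilon>]
      by (auto simp: less_2_cases_iff X_mat_eq case_prod_beta' Complex_eq algebra_simps)
  qed
  from this[of 1] this[of "-1"] show "poly_mat 2 2 X_mat" "poly_mat 2 2 (\<lambda>(p, p0). X_mat (- p, p0))"
    by (simp_all add: case_prod_beta')
qed

section \<open>The spin sum\<close>

lemma mat_smult_smult: "a \<cdot>\<^sub>m (b \<cdot>\<^sub>m M) = (a * b :: 'a :: semigroup_mult) \<cdot>\<^sub>m M"
  by (rule eq_matI) (auto simp: mult.assoc)

text \<open>With determinant 1 the inverse is the adjugate, and adjugation carries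
  \<open>X_mat (p, p0)\<close> to \<open>X_mat (- p, p0)\<close>.\<close>

lemma boost_inverse:
  assumes "m > 0"
  obtains N where "N \<in> carrier_mat 2 2" "boost m p * N = 1\<^sub>m 2" "mat_adjoint N = N"
    "complex_of_real m \<cdot>\<^sub>m (N * N) = X_mat (- p, energy m p)"
proof -
  note L = boost_properties[OF assms, of p]
  have Lc: "boost m p \<in> carrier_mat 2 2" "Determinant.det (boost m p) = 1"
    using L(1) by (auto simp: SL2C_def)
  obtain a d :: real and b where Le: "boost m p = mat2 a b (cnj b) d"
    using Lc(1) L(2) by (rule hermitian_mat2)
  have det: "a * d - b * cnj b = 1" using Lc by (simp add: Le)
  show thesis
  proof (rule that[of "mat2 d (- b) (- cnj b) a"])
    show "boost m p * mat2 d (- b) (- cnj b) a = 1\<^sub>m 2"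
      using det by (simp add: Le one_mat2 algebra_simps)
    have e: "complex_of_real m * (a * a + b * cnj b) = complex_of_real (energy m p - p $ 3)"
      "complex_of_real m * (a * b + b * d) = Complex (- (p $ 1)) (p $ 2)"
      "complex_of_real m * (cnj b * a + d * cnj b) = Complex (- (p $ 1)) (- (p $ 2))"
      "complex_of_real m * (cnj b * b + d * d) = complex_of_real (energy m p + p $ 3)"
      using L(3) unfolding Le X_mat_eq by simp_all
    have "X_mat (- p, energy m p) =
        mat2 (complex_of_real (energy m p + p $ 3)) (- Complex (- (p $ 1)) (p $ 2))
          (- Complex (- (p $ 1)) (- (p $ 2))) (complex_of_real (energy m p - p $ 3))"
      by (simp add: X_mat_eq complex_eq_iff)
    then show "complex_of_real m \<cdot>\<^sub>m (mat2 d (- b) (- cnj b) a * mat2 d (- b) (- cnj b) a) =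
        X_mat (- p, energy m p)"
      unfolding e[symmetric] by (simp add: algebra_simps)
  qed simp_all
qed

text \<open>Removes the inverse adjoint from \<open>AB_rep\<close> once an inverse \<open>h\<close>
  of \<open>mat_adjoint g\<close> is known. For the boost it is the inverse boost, for SU(2) it is
  \<open>g\<close> itself.\<close>

lemma AB_rep_eq_tensor_rep:
  assumes "g \<in> carrier_mat 2 2" "h \<in> carrier_mat 2 2" "mat_adjoint g * h = 1\<^sub>m 2"
  shows "AB_rep A B g = tensor_rep A B g h"
  using mat_inverse_eqI[OF mat_adjoint_carrier[OF assms(1)] assms(2,3)]
  by (simp add: AB_rep_def tensor_rep_def)

lemma AB_rep_SU2: "W \<in> SU2 \<Longrightarrow> AB_rep A B W = tensor_rep A B W W"
  by (rule AB_rep_eq_tensor_rep) (auto simp: SU2_def SL2C_def)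

text \<open>Both rest matrices intertwine with spin \<open>j\<close>. Taking the adjoint of the
  relation for \<open>v0\<close> at \<open>mat_adjoint W\<close> moves \<open>W\<close> through
  \<open>mat_adjoint v0\<close>.\<close>

lemma rest_coefficient_intertwiner:
  assumes u: "rest_coefficient A B j u0" and v: "rest_coefficient C D j v0" and W: "W \<in> SU2"
  shows "(u0 * mat_adjoint v0) * tensor_rep C D W W = tensor_rep A B W W * (u0 * mat_adjoint v0)"
proof -
  have Wc: "W \<in> carrier_mat 2 2" using W by (simp add: SU2_def SL2C_def)
  have uc: "u0 \<in> carrier_mat (AB_dim A B) (twice j + 1)"
    and vc: "v0 \<in> carrier_mat (AB_dim C D) (twice j + 1)"
    using u v by (auto simp: rest_coefficient_def)
  note vc' = mat_adjoint_carrier[OF vc]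
  have ui: "u0 * spin_rep j W = tensor_rep A B W W * u0"
    using u W by (simp add: rest_coefficient_def AB_rep_SU2)
  have "v0 * spin_rep j (mat_adjoint W) = tensor_rep C D (mat_adjoint W) (mat_adjoint W) * v0"
    using v SU2_adjoint[OF W] by (simp add: rest_coefficient_def AB_rep_SU2)
  then have "mat_adjoint (v0 * spin_rep j (mat_adjoint W)) =
      mat_adjoint (tensor_rep C D (mat_adjoint W) (mat_adjoint W) * v0)" by simp
  then have vi: "spin_rep j W * mat_adjoint v0 = mat_adjoint v0 * tensor_rep C D W W"
    unfolding mat_adjoint_mult[OF vc spin_rep_carrier] mat_adjoint_mult[OF tensor_rep_carrier vc]
    using Wc by (simp add: spin_rep_adjoint tensor_rep_adjoint)
  have "(u0 * mat_adjoint v0) * tensor_rep C D W W = u0 * (spin_rep j W * mat_adjoint v0)"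
    unfolding vi by (rule assoc_mult_mat[OF uc vc' tensor_rep_carrier])
  also have "\<dots> = tensor_rep A B W W * u0 * mat_adjoint v0"
    unfolding ui[symmetric] by (rule assoc_mult_mat[OF uc spin_rep_carrier vc', symmetric])
  also have "\<dots> = tensor_rep A B W W * (u0 * mat_adjoint v0)"
    by (rule assoc_mult_mat[OF tensor_rep_carrier uc vc'])
  finally show ?thesis .
qed

text \<open>
  Moving the factor \<open>D\<^sup>C(L) \<otimes> D\<^sup>D(L)\<close> of \<open>D\<^sup>C(L) \<otimes> D\<^sup>D(L\<^sup>-\<^sup>1)\<close> through \<open>M\<close> leaves only even powers of \<open>L\<close>.
\<close>

lemma boosted_intertwiner:
  assumes M: "M \<in> carrier_mat (AB_dim A B) (AB_dim C D)"
    and int: "M * tensor_rep C D L L = tensor_rep A B L L * M"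
    and L: "L \<in> carrier_mat 2 2" and N: "N \<in> carrier_mat 2 2" and LN: "L * N = 1\<^sub>m 2"
  shows "tensor_rep A B L N * M * tensor_rep C D L N =
    tensor_rep A B (L * L) (1\<^sub>m 2) * M * tensor_rep C D (1\<^sub>m 2) (N * N)"
proof -
  let ?T = "tensor_rep C D (1\<^sub>m 2) (N * N)"
  have NL: "N * L = 1\<^sub>m 2" by (rule mat_mult_left_right_inverse[OF L N LN])
  \<comment> \<open>Splits the pair \<open>(L, N)\<close> as \<open>(L, L)\<close> times
    \<open>(1, N^2)\<close>, which exposes the factor that \<open>M\<close> intertwines.\<close>
  have "L * (N * N) = N" using L N LN by (simp add: assoc_mult_mat[OF L N N, symmetric])
  then have 1: "tensor_rep C D L N = tensor_rep C D L L * ?T"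
    using L N by (simp add: tensor_rep_mult)
  have 2: "tensor_rep A B L N * tensor_rep A B L L = tensor_rep A B (L * L) (1\<^sub>m 2)"
    using L N NL by (simp add: tensor_rep_mult)
  have "tensor_rep A B L N * M * tensor_rep C D L N = tensor_rep A B L N * (M * (tensor_rep C D L L * ?T))"
    unfolding 1 by (rule assoc_mult_mat[OF tensor_rep_carrier M mult_carrier_mat[OF tensor_rep_carrier tensor_rep_carrier]])
  also have "M * (tensor_rep C D L L * ?T) = tensor_rep A B L L * M * ?T"
    unfolding int[symmetric] by (rule assoc_mult_mat[OF M tensor_rep_carrier tensor_rep_carrier, symmetric])
  also have "\<dots> = tensor_rep A B L L * (M * ?T)"
    by (rule assoc_mult_mat[OF tensor_rep_carrier M tensor_rep_carrier])
  also have "tensor_rep A B L N * \<dots> = tensor_rep A B (L * L) (1\<^sub>m 2) * (M * ?T)"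
    unfolding 2[symmetric]
    by (rule assoc_mult_mat[OF tensor_rep_carrier tensor_rep_carrier mult_carrier_mat[OF M tensor_rep_carrier], symmetric])
  also have "\<dots> = tensor_rep A B (L * L) (1\<^sub>m 2) * M * ?T"
    by (rule assoc_mult_mat[OF tensor_rep_carrier M tensor_rep_carrier, symmetric])
  finally show ?thesis .
qed

text \<open>The two boosts surround \<open>u0 * mat_adjoint v0\<close>, an intertwiner to which
  \<open>boosted_intertwiner\<close> applies; the remaining squares of the boost and of its inverse
  are linear in the momentum.\<close>

lemma spin_sum_eq:
  assumes m: "m > 0" and u: "rest_coefficient A B j u0" and v: "rest_coefficient C D j v0"
  shows "spin_sum m A B u0 C D v0 p = complex_of_real (2 * m) \<cdot>\<^sub>m
    (tensor_rep A B (complex_of_real (1 / m) \<cdot>\<^sub>m X_mat (p, energy m p)) (1\<^sub>m 2) * (u0 * mat_adjoint v0) *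
     tensor_rep C D (1\<^sub>m 2) (complex_of_real (1 / m) \<cdot>\<^sub>m X_mat (- p, energy m p)))"
proof -
  define L where "L = boost m p"
  define E where "E = energy m p"
  define M where "M = u0 * mat_adjoint v0"
  define c where "c = complex_of_real (sqrt (m / E))"
  have "E > 0" using m by (simp add: E_def energy_def add_nonneg_pos)
  have uc: "u0 \<in> carrier_mat (AB_dim A B) (twice j + 1)"
    and vc: "v0 \<in> carrier_mat (AB_dim C D) (twice j + 1)"
    using u v by (auto simp: rest_coefficient_def)
  note vc' = mat_adjoint_carrier[OF vc]
  have Mc: "M \<in> carrier_mat (AB_dim A B) (AB_dim C D)"
    unfolding M_def by (rule mult_carrier_mat[OF uc vc'])
  note Lp = boost_properties[OF m, of p, folded L_def E_def]
  then have Lc: "L \<in> carrier_mat 2 2" by (simp add: SL2C_def)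
  obtain N where N: "N \<in> carrier_mat 2 2" "L * N = 1\<^sub>m 2" "mat_adjoint N = N"
    "complex_of_real m \<cdot>\<^sub>m (N * N) = X_mat (- p, E)"
    using boost_inverse[OF m, of p] unfolding L_def E_def by metis
  \<comment> \<open>As \<open>L\<close> is Hermitian, its inverse adjoint is
    \<open>N\<close>.\<close>
  have rep: "AB_rep A B L = tensor_rep A B L N" for A B
    using Lc N Lp by (intro AB_rep_eq_tensor_rep) auto
  have square: "K * K = complex_of_real (1 / m) \<cdot>\<^sub>m X"
    if "complex_of_real m \<cdot>\<^sub>m (K * K) = X" for K X
    using m by (auto simp flip: that)
  have "spin_sum m A B u0 C D v0 p = complex_of_real (2 * E) \<cdot>\<^sub>m
      (c \<cdot>\<^sub>m (tensor_rep A B L N * u0) * mat_adjoint (c \<cdot>\<^sub>m (tensor_rep C D L N * v0)))"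
    by (simp add: spin_sum_def coefficient_function_def rep flip: L_def E_def c_def)
  \<comment> \<open>\<open>L\<close> and \<open>N\<close> are Hermitian and \<open>c\<close> is
    real, so the boost factor and the scalar are self-adjoint.\<close>
  also have "mat_adjoint (c \<cdot>\<^sub>m (tensor_rep C D L N * v0)) =
      c \<cdot>\<^sub>m (mat_adjoint v0 * tensor_rep C D L N)"
    unfolding mat_adjoint_smult mat_adjoint_mult[OF tensor_rep_carrier vc] tensor_rep_adjoint[OF Lc N(1)] Lp(2) N(3)
    by (simp add: c_def)
  also have "c \<cdot>\<^sub>m (tensor_rep A B L N * u0) * (c \<cdot>\<^sub>m (mat_adjoint v0 * tensor_rep C D L N)) =
      (c * c) \<cdot>\<^sub>m ((tensor_rep A B L N * u0) * (mat_adjoint v0 * tensor_rep C D L N))"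
    using mult_smult_assoc_mat[OF mult_carrier_mat[OF tensor_rep_carrier uc]
        smult_carrier_mat[OF mult_carrier_mat[OF vc' tensor_rep_carrier]]]
      mult_smult_distrib[OF mult_carrier_mat[OF tensor_rep_carrier uc]
        mult_carrier_mat[OF vc' tensor_rep_carrier]]
    by (simp add: mat_smult_smult)
  also have "(tensor_rep A B L N * u0) * (mat_adjoint v0 * tensor_rep C D L N) =
      tensor_rep A B L N * M * tensor_rep C D L N"
    unfolding M_def assoc_mult_mat[OF mult_carrier_mat[OF tensor_rep_carrier uc] vc' tensor_rep_carrier, symmetric]
      assoc_mult_mat[OF tensor_rep_carrier uc vc'] ..
  also have "\<dots> = tensor_rep A B (L * L) (1\<^sub>m 2) * M * tensor_rep C D (1\<^sub>m 2) (N * N)"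
  proof (rule boosted_intertwiner[OF Mc _ Lc N(1,2)])
    show "M * tensor_rep C D L L = tensor_rep A B L L * M"
      by (rule intertwiner_hermitian[OF Mc _ Lp(1,2)])
        (unfold M_def, rule rest_coefficient_intertwiner[OF u v])
  qed
  also have "complex_of_real (2 * E) \<cdot>\<^sub>m ((c * c) \<cdot>\<^sub>m (tensor_rep A B (L * L) (1\<^sub>m 2) * M * tensor_rep C D (1\<^sub>m 2) (N * N)))
      = complex_of_real (2 * m) \<cdot>\<^sub>m (tensor_rep A B (L * L) (1\<^sub>m 2) * M * tensor_rep C D (1\<^sub>m 2) (N * N))"
  proof -
    \<comment> \<open>The two normalization factors multiply to \<open>m / E\<close>, cancelling the
      energy and with it the only non-polynomial dependence.\<close>
    have "2 * E * (sqrt (m / E) * sqrt (m / E)) = 2 * m" using m \<open>E > 0\<close> by simp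
    then have "complex_of_real (2 * E) * (c * c) = complex_of_real (2 * m)"
      unfolding c_def of_real_mult[symmetric] by (simp only:)
    then show ?thesis by (simp only: mat_smult_smult)
  qed
  finally show ?thesis
    unfolding square[OF Lp(3)] square[OF N(4)] M_def E_def .
qed

section \<open>Reversal of the 4-vector and the final assembly\<close>

lemma X_mat_uminus: "X_mat (- p, - p0) = (- 1) \<cdot>\<^sub>m X_mat (p, p0)"
  by (simp add: X_mat_eq complex_eq_iff)

lemma X_mat_carrier [simp]: "X_mat q \<in> carrier_mat 2 2"
  by (cases q) (simp add: X_mat_eq)

lemma tensor_rep_smult:
  assumes "g \<in> carrier_mat 2 2" "h \<in> carrier_mat 2 2"
  shows "tensor_rep A B (c \<cdot>\<^sub>m g) h = c ^ twice A \<cdot>\<^sub>m tensor_rep A B g h"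
    and "tensor_rep A B g (c \<cdot>\<^sub>m h) = c ^ twice B \<cdot>\<^sub>m tensor_rep A B g h"
  using assms by (simp_all add: tensor_rep_def spin_rep_smult kronecker_smult)

lemma poly_mat_tensor_rep:
  "poly_mat 2 2 F \<Longrightarrow> poly_mat 2 2 G \<Longrightarrow>
    poly_mat (AB_dim A B) (AB_dim A B) (\<lambda>q. tensor_rep A B (F q) (G q))"
  unfolding tensor_rep_def AB_dim_def by (intro poly_mat_kronecker poly_mat_spin_rep)

theorem theorem3p1:
  fixes m j A B C D :: real and u0 v0 :: "complex mat"
  assumes "m > 0"
    and "nonneg_half_integer j"
    and "nonneg_half_integer A" and "nonneg_half_integer B"
    and "nonneg_half_integer C" and "nonneg_half_integer D"
    and "\<bar>A - B\<bar> \<le> j" and "j \<le> A + B" and "A + B - j \<in> \<int>"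
    and "\<bar>C - D\<bar> \<le> j" and "j \<le> C + D" and "C + D - j \<in> \<int>"
    and "rest_coefficient A B j u0" and "rest_coefficient C D j v0"
  shows "\<exists>P. matrix_polynomial (AB_dim A B) (AB_dim C D) P \<and>
     (\<forall>p. spin_sum m A B u0 C D v0 p = P (p, energy m p)) \<and>
     (\<forall>p p0. P (- p, - p0) = (- 1) ^ (twice A + twice D) \<cdot>\<^sub>m P (p, p0))"
proof -
  define M where "M = u0 * mat_adjoint v0"
  have M: "M \<in> carrier_mat (AB_dim A B) (AB_dim C D)"
    unfolding M_def using \<open>rest_coefficient A B j u0\<close> \<open>rest_coefficient C D j v0\<close>
    by (intro mult_carrier_mat[of _ _ "twice j + 1"] mat_adjoint_carrier)
      (simp_all add: rest_coefficient_def)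
  \<comment> \<open>\<open>F\<close> and \<open>G\<close> are the two outer factors of
    \<open>spin_sum_eq\<close> with the energy replaced by a free variable, hence defined off the
    mass shell.\<close>
  define F where "F q = tensor_rep A B (complex_of_real (1 / m) \<cdot>\<^sub>m X_mat q) (1\<^sub>m 2)" for q
  define G where "G q = tensor_rep C D (1\<^sub>m 2)
    (complex_of_real (1 / m) \<cdot>\<^sub>m (case q of (p, p0) \<Rightarrow> X_mat (- p, p0)))" for q
  have Fc: "F q \<in> carrier_mat (AB_dim A B) (AB_dim A B)"
    and Gc: "G q \<in> carrier_mat (AB_dim C D) (AB_dim C D)" for q
    by (simp_all add: F_def G_def)
  define P where "P q = complex_of_real (2 * m) \<cdot>\<^sub>m (F q * M * G q)" for q
  have "poly_mat (AB_dim A B) (AB_dim A B) F" "poly_mat (AB_dim C D) (AB_dim C D) G"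
    unfolding F_def G_def
    by (intro poly_mat_tensor_rep poly_mat_smult poly_mat_const poly_mat_X_mat one_carrier_mat)+
  then have "poly_mat (AB_dim A B) (AB_dim C D) P"
    unfolding P_def using M by (intro poly_mat_smult) (rule poly_mat_mult[OF poly_mat_mult[OF _ poly_mat_const]])
  moreover have "spin_sum m A B u0 C D v0 p = P (p, energy m p)" for p
    using spin_sum_eq[OF \<open>m > 0\<close> \<open>rest_coefficient A B j u0\<close> \<open>rest_coefficient C D j v0\<close>]
    by (simp add: P_def F_def G_def M_def)
  moreover have "P (- p, - p0) = (- 1) ^ (twice A + twice D) \<cdot>\<^sub>m P (p, p0)" for p p0
  proof -
    \<comment> \<open>Brings the sign to the outside of the scaling by \<open>1 / m\<close>, so that
      homogeneity can pull it out.\<close>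
    have swap: "c \<cdot>\<^sub>m ((- 1) \<cdot>\<^sub>m X) = (- 1) \<cdot>\<^sub>m (c \<cdot>\<^sub>m X)" for c :: complex and X
      by (simp add: mat_smult_smult)
    \<comment> \<open>The momentum enters \<open>F\<close> only through the spin-\<open>A\<close>
      slot and \<open>G\<close> only through the spin-\<open>D\<close> slot, so the exponents are
      \<open>twice A\<close> and \<open>twice D\<close>.\<close>
    have "F (- p, - p0) = (- 1) ^ twice A \<cdot>\<^sub>m F (p, p0)"
      unfolding F_def X_mat_uminus swap by (rule tensor_rep_smult) simp_all
    moreover have "G (- p, - p0) = (- 1) ^ twice D \<cdot>\<^sub>m G (p, p0)"
      unfolding G_def prod.case X_mat_uminus swap by (rule tensor_rep_smult) simp_all
    ultimately have "P (- p, - p0) = complex_of_real (2 * m) \<cdot>\<^sub>m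
        (((- 1) ^ twice A \<cdot>\<^sub>m F (p, p0)) * M * ((- 1) ^ twice D \<cdot>\<^sub>m G (p, p0)))"
      by (simp add: P_def)
    also have "\<dots> = (- 1) ^ (twice A + twice D) \<cdot>\<^sub>m P (p, p0)"
      unfolding P_def mult_smult_assoc_mat[OF Fc M]
        mult_smult_assoc_mat[OF mult_carrier_mat[OF Fc M] smult_carrier_mat[OF Gc]]
        mult_smult_distrib[OF mult_carrier_mat[OF Fc M] Gc]
      by (simp add: mat_smult_smult power_add mult_ac)
    finally show ?thesis .
  qed
  ultimately show ?thesis using matrix_polynomial_poly_mat by blast
qed

end
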